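(* In $\mathrm{LF}_\Delta$: (1) if $\Gamma\vdash_\Sigma K$ and $K\to_\Delta K'$ then $\Gamma\vdash_\Sigma K'$; (2) if $\Gamma\vdash_\Sigma\sigma:K$ and $\sigma\to_\Delta\sigma'$ then $\Gamma\vdash_\Sigma\sigma':K$; (3) if $\Gamma\vdash_\Sigma\Delta:\sigma$ and $\Delta\to_\Delta\Delta'$ then $\Gamma\vdash_\Sigma\Delta':\sigma$.
   Context: $\mathrm{LF}_\Delta$ pseudo-terms (up to $\alpha$-conversion; $a$ family constants, $c$ object constants, $x,y$ variables): Kinds $K ::= \mathrm{Type} \mid \Pi x{:}\sigma.K$; Families $\sigma,\tau ::= a \mid \Pi x{:}\sigma.\tau \mid \sigma\,\Delta \mid \sigma\to^{r}\tau \mid \sigma\cap\tau \mid \sigma\cup\tau$; Objects $\Delta ::= c \mid x \mid \lambda x{:}\sigma.\Delta \mid \Delta\,\Delta \mid \lambda^{r}x{:}\sigma.\Delta \mid \Delta @^{r}\Delta \mid \langle\Delta,\Delta\rangle \mid [\Delta,\Delta] \mid pr_l\,\Delta \mid pr_r\,\Delta \mid in_l^{\sigma}\,\Delta \mid in_r^{\sigma}\,\Delta$. Essence $|\Delta|$ (pure $\lambda$-term): $|c|=c$, $|x|=x$, $|\lambda x{:}\sigma.\Delta|=|\lambda^r x{:}\sigma.\Delta|=\lambda x.|\Delta|$, $|\Delta_1\Delta_2|=|\Delta_1||\Delta_2|$, $|\Delta_1@^r\Delta_2|=|\Delta_2|$, $|\langle\Delta_1,\Delta_2\rangle|=|[\Delta_1,\Delta_2]|=|\Delta_1|$,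 $|pr_i\Delta|=|in_i^\sigma\Delta|=|\Delta|$. Pairs/co-pairs are only considered when their components have identical essences. Reduction $\to_\Delta$: basic rules $(\lambda x{:}\sigma.\Delta_1)\Delta_2\to\Delta_1[\Delta_2/x]$, $pr_l\langle\Delta_1,\Delta_2\rangle\to\Delta_1$, $pr_r\langle\Delta_1,\Delta_2\rangle\to\Delta_2$, $[\Delta_1,\Delta_2](in_l^\sigma\Delta_3)\to\Delta_1\Delta_3$, $[\Delta_1,\Delta_2](in_r^\sigma\Delta_3)\to\Delta_2\Delta_3$, $(\lambda^r x{:}\sigma.\Delta_1)@^r\Delta_2\to\Delta_1[\Delta_2/x]$, closed under all constructors, except that components of pairs/co-pairs are reduced simultaneously ($\langle\Delta_1,\Delta_2\rangle\to\langle\Delta_1',\Delta_2'\rangle$, $[\Delta_1,\Delta_2]\to[\Delta_1',\Delta_2']$ when $\Delta_i\to\Delta_i'$ for $i=1,2$ and $|\Delta_1'|\equiv|\Delta_2'|$). $=_\Delta$ is the equivalence closure of $\to_\Delta$; $=_\eta$ is $\eta$-equality of pure $\lambda$-terms. Judgements $\vdash\Sigma$, $\vdash_\Sigma\Gamma$, $\Gamma\vdash_\Sigma K$, $\Gamma\vdash_\Sigma\sigma:K$, $\Gamma\vdash_\Sigma\Delta:\sigma$, with rules: Signatures: $\vdash\emptyset$; $\vdash\Sigma,a{:}K$ if $\vdash\Sigma$, $\vdash_\Sigma K$, $a\notin\mathrm{dom}\,\Sigma$; $\vdash\Sigma,c{:}\sigma$ if $\vdash\Sigma$, $\vdash_\Sigma\sigma:\mathrm{Type}$,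 $c\notin\mathrm{dom}\,\Sigma$. Contexts: $\vdash_\Sigma\langle\rangle$ if $\vdash\Sigma$; $\vdash_\Sigma\Gamma,x{:}\sigma$ if $\vdash_\Sigma\Gamma$, $\Gamma\vdash_\Sigma\sigma:\mathrm{Type}$, $x\notin\mathrm{dom}\,\Gamma$. Kinds: $\Gamma\vdash_\Sigma\mathrm{Type}$ if $\vdash_\Sigma\Gamma$; $\Gamma\vdash_\Sigma\Pi x{:}\sigma.K$ if $\Gamma,x{:}\sigma\vdash_\Sigma K$. Families: $\Gamma\vdash_\Sigma a:K$ if $\vdash_\Sigma\Gamma$, $a{:}K\in\Sigma$; $\Gamma\vdash_\Sigma\Pi x{:}\sigma.\tau:\mathrm{Type}$ if $\Gamma,x{:}\sigma\vdash_\Sigma\tau:\mathrm{Type}$; $\Gamma\vdash_\Sigma\sigma\,\Delta:K[\Delta/x]$ if $\Gamma\vdash_\Sigma\sigma:\Pi x{:}\tau.K$, $\Gamma\vdash_\Sigma\Delta:\tau$; $\sigma\to^r\tau$, $\sigma\cap\tau$, $\sigma\cup\tau$ have kind $\mathrm{Type}$ if $\sigma,\tau$ do; $\Gamma\vdash_\Sigma\sigma:K_2$ if $\Gamma\vdash_\Sigma\sigma:K_1$, $\Gamma\vdash_\Sigma K_2$, $K_1=_\Delta K_2$. Objects (all in $\Gamma$, $\Sigma$): constants and variables get their declared type in a valid context; $\lambda x{:}\sigma.\Delta:\Pi x{:}\sigma.\tau$ if $\Gamma,x{:}\sigma\vdash_\Sigma\Delta:\tau$; $\Delta_1\Delta_2:\tau[\Delta_2/x]$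 if $\Delta_1:\Pi x{:}\sigma.\tau$, $\Delta_2:\sigma$; $\lambda^r x{:}\sigma.\Delta:\sigma\to^r\tau$ if $\Gamma,x{:}\sigma\vdash_\Sigma\Delta:\tau$ and $|\Delta|=_\eta x$; $\Delta_1@^r\Delta_2:\tau$ if $\Delta_1:\sigma\to^r\tau$, $\Delta_2:\sigma$; $\langle\Delta_1,\Delta_2\rangle:\sigma\cap\tau$ if $\Delta_1:\sigma$, $\Delta_2:\tau$, $|\Delta_1|=_\eta|\Delta_2|$; $pr_l\Delta:\sigma$ and $pr_r\Delta:\tau$ if $\Delta:\sigma\cap\tau$; $in_l^\tau\Delta:\sigma\cup\tau$ if $\Delta:\sigma$ and $\sigma\cup\tau:\mathrm{Type}$; $in_r^\sigma\Delta:\sigma\cup\tau$ if $\Delta:\tau$ and $\sigma\cup\tau:\mathrm{Type}$; $[\Delta_1,\Delta_2]:\Pi x{:}\sigma\cup\tau.\rho$ if $\Delta_1:\Pi y{:}\sigma.\rho[in_l^\tau y/x]$, $\Delta_2:\Pi y{:}\tau.\rho[in_r^\sigma y/x]$, $|\Delta_1|=_\eta|\Delta_2|$, $\Gamma,x{:}\sigma\cup\tau\vdash_\Sigma\rho:\mathrm{Type}$; conversion: $\Delta:\tau$ if $\Delta:\sigma$, $\Gamma\vdash_\Sigma\tau:\mathrm{Type}$, $\sigma=_\Delta\tau$.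
   Formalization: In the rule for λ^r x:σ.Δ : σ→^r τ, it is additionally required that x is not free in τ and that Γ ⊢ σ→^r τ : Type; without a restriction, x may dangle in τ and claim (3) fails for (λ^r x:σ.Δ)@^r Δ'. *)

theory Defs
  imports Main
begin

(* Terms are taken up to alpha-conversion by using de Bruijn indices: the body of every
   binder refers to the bound variable as index 0.  Family constants range over 'a,
   object constants over 'c. *)

datatype ('a, 'c) fam =
    FConst 'a
  | FPi "('a, 'c) fam" "('a, 'c) fam"        (* binds in the 2nd argument *)
  | FApp "('a, 'c) fam" "('a, 'c) obj"
  | FRel "('a, 'c) fam" "('a, 'c) fam"       (* relevant arrow, no binding *)
  | FInter "('a, 'c) fam" "('a, 'c) fam"
  | FUnion "('a, 'c) fam" "('a, 'c) fam"
and ('a, 'c) obj =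
    Const 'c
  | Var nat
  | Lam "('a, 'c) fam" "('a, 'c) obj"        (* binds in the 2nd argument *)
  | App "('a, 'c) obj" "('a, 'c) obj"
  | RLam "('a, 'c) fam" "('a, 'c) obj"       (* relevant abstraction, binds in the 2nd argument *)
  | RApp "('a, 'c) obj" "('a, 'c) obj"       (* relevant application *)
  | Pair "('a, 'c) obj" "('a, 'c) obj"
  | Copair "('a, 'c) obj" "('a, 'c) obj"
  | PrL "('a, 'c) obj"
  | PrR "('a, 'c) obj"
  | InL "('a, 'c) fam" "('a, 'c) obj"
  | InR "('a, 'c) fam" "('a, 'c) obj"

datatype ('a, 'c) kind =
    KType
  | KPi "('a, 'c) fam" "('a, 'c) kind"       (* binds in the 2nd argument *)

(* Simultaneous renaming and capture-avoiding substitution. *)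

definition up_ren :: "(nat \<Rightarrow> nat) \<Rightarrow> nat \<Rightarrow> nat" where
  "up_ren \<xi> = case_nat 0 (\<lambda>n. Suc (\<xi> n))"

primrec ren_fam :: "(nat \<Rightarrow> nat) \<Rightarrow> ('a, 'c) fam \<Rightarrow> ('a, 'c) fam"
  and ren_obj :: "(nat \<Rightarrow> nat) \<Rightarrow> ('a, 'c) obj \<Rightarrow> ('a, 'c) obj" where
  "ren_fam \<xi> (FConst a) = FConst a"
| "ren_fam \<xi> (FPi \<sigma> \<tau>) = FPi (ren_fam \<xi> \<sigma>) (ren_fam (up_ren \<xi>) \<tau>)"
| "ren_fam \<xi> (FApp \<sigma> \<Delta>) = FApp (ren_fam \<xi> \<sigma>) (ren_obj \<xi> \<Delta>)"
| "ren_fam \<xi> (FRel \<sigma> \<tau>) = FRel (ren_fam \<xi> \<sigma>) (ren_fam \<xi> \<tau>)"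
| "ren_fam \<xi> (FInter \<sigma> \<tau>) = FInter (ren_fam \<xi> \<sigma>) (ren_fam \<xi> \<tau>)"
| "ren_fam \<xi> (FUnion \<sigma> \<tau>) = FUnion (ren_fam \<xi> \<sigma>) (ren_fam \<xi> \<tau>)"
| "ren_obj \<xi> (Const c) = Const c"
| "ren_obj \<xi> (Var n) = Var (\<xi> n)"
| "ren_obj \<xi> (Lam \<sigma> \<Delta>) = Lam (ren_fam \<xi> \<sigma>) (ren_obj (up_ren \<xi>) \<Delta>)"
| "ren_obj \<xi> (App \<Delta>1 \<Delta>2) = App (ren_obj \<xi> \<Delta>1) (ren_obj \<xi> \<Delta>2)"
| "ren_obj \<xi> (RLam \<sigma> \<Delta>) = RLam (ren_fam \<xi> \<sigma>) (ren_obj (up_ren \<xi>) \<Delta>)"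
| "ren_obj \<xi> (RApp \<Delta>1 \<Delta>2) = RApp (ren_obj \<xi> \<Delta>1) (ren_obj \<xi> \<Delta>2)"
| "ren_obj \<xi> (Pair \<Delta>1 \<Delta>2) = Pair (ren_obj \<xi> \<Delta>1) (ren_obj \<xi> \<Delta>2)"
| "ren_obj \<xi> (Copair \<Delta>1 \<Delta>2) = Copair (ren_obj \<xi> \<Delta>1) (ren_obj \<xi> \<Delta>2)"
| "ren_obj \<xi> (PrL \<Delta>) = PrL (ren_obj \<xi> \<Delta>)"
| "ren_obj \<xi> (PrR \<Delta>) = PrR (ren_obj \<xi> \<Delta>)"
| "ren_obj \<xi> (InL \<sigma> \<Delta>) = InL (ren_fam \<xi> \<sigma>) (ren_obj \<xi> \<Delta>)"
| "ren_obj \<xi> (InR \<sigma> \<Delta>) = InR (ren_fam \<xi> \<sigma>) (ren_obj \<xi> \<Delta>)"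

definition up_sub :: "(nat \<Rightarrow> ('a, 'c) obj) \<Rightarrow> nat \<Rightarrow> ('a, 'c) obj" where
  "up_sub \<theta> = case_nat (Var 0) (\<lambda>n. ren_obj Suc (\<theta> n))"

primrec sub_fam :: "(nat \<Rightarrow> ('a, 'c) obj) \<Rightarrow> ('a, 'c) fam \<Rightarrow> ('a, 'c) fam"
  and sub_obj :: "(nat \<Rightarrow> ('a, 'c) obj) \<Rightarrow> ('a, 'c) obj \<Rightarrow> ('a, 'c) obj" where
  "sub_fam \<theta> (FConst a) = FConst a"
| "sub_fam \<theta> (FPi \<sigma> \<tau>) = FPi (sub_fam \<theta> \<sigma>) (sub_fam (up_sub \<theta>) \<tau>)"
| "sub_fam \<theta> (FApp \<sigma> \<Delta>) = FApp (sub_fam \<theta> \<sigma>) (sub_obj \<theta> \<Delta>)"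
| "sub_fam \<theta> (FRel \<sigma> \<tau>) = FRel (sub_fam \<theta> \<sigma>) (sub_fam \<theta> \<tau>)"
| "sub_fam \<theta> (FInter \<sigma> \<tau>) = FInter (sub_fam \<theta> \<sigma>) (sub_fam \<theta> \<tau>)"
| "sub_fam \<theta> (FUnion \<sigma> \<tau>) = FUnion (sub_fam \<theta> \<sigma>) (sub_fam \<theta> \<tau>)"
| "sub_obj \<theta> (Const c) = Const c"
| "sub_obj \<theta> (Var n) = \<theta> n"
| "sub_obj \<theta> (Lam \<sigma> \<Delta>) = Lam (sub_fam \<theta> \<sigma>) (sub_obj (up_sub \<theta>) \<Delta>)"
| "sub_obj \<theta> (App \<Delta>1 \<Delta>2) = App (sub_obj \<theta> \<Delta>1) (sub_obj \<theta> \<Delta>2)"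
| "sub_obj \<theta> (RLam \<sigma> \<Delta>) = RLam (sub_fam \<theta> \<sigma>) (sub_obj (up_sub \<theta>) \<Delta>)"
| "sub_obj \<theta> (RApp \<Delta>1 \<Delta>2) = RApp (sub_obj \<theta> \<Delta>1) (sub_obj \<theta> \<Delta>2)"
| "sub_obj \<theta> (Pair \<Delta>1 \<Delta>2) = Pair (sub_obj \<theta> \<Delta>1) (sub_obj \<theta> \<Delta>2)"
| "sub_obj \<theta> (Copair \<Delta>1 \<Delta>2) = Copair (sub_obj \<theta> \<Delta>1) (sub_obj \<theta> \<Delta>2)"
| "sub_obj \<theta> (PrL \<Delta>) = PrL (sub_obj \<theta> \<Delta>)"
| "sub_obj \<theta> (PrR \<Delta>) = PrR (sub_obj \<theta> \<Delta>)"
| "sub_obj \<theta> (InL \<sigma> \<Delta>) = InL (sub_fam \<theta> \<sigma>) (sub_obj \<theta> \<Delta>)"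
| "sub_obj \<theta> (InR \<sigma> \<Delta>) = InR (sub_fam \<theta> \<sigma>) (sub_obj \<theta> \<Delta>)"

primrec sub_kind :: "(nat \<Rightarrow> ('a, 'c) obj) \<Rightarrow> ('a, 'c) kind \<Rightarrow> ('a, 'c) kind" where
  "sub_kind \<theta> KType = KType"
| "sub_kind \<theta> (KPi \<sigma> K) = KPi (sub_fam \<theta> \<sigma>) (sub_kind (up_sub \<theta>) K)"

(* "sub_... (inst \<Delta>) t" is t[\<Delta>/x] where x is the outermost bound variable: index 0 is
   replaced by \<Delta> and the remaining indices are decremented. *)
definition inst :: "('a, 'c) obj \<Rightarrow> nat \<Rightarrow> ('a, 'c) obj" where
  "inst \<Delta> = case_nat \<Delta> Var"

(* "sub_... (repl \<Delta>) t" is t[\<Delta>/x] where t lives in "\<Gamma>, x:_" and \<Delta> lives in "\<Gamma>, y:_":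
   index 0 is replaced by \<Delta>, all other indices stay. *)
definition repl :: "('a, 'c) obj \<Rightarrow> nat \<Rightarrow> ('a, 'c) obj" where
  "repl \<Delta> = case_nat \<Delta> (\<lambda>n. Var (Suc n))"

(* Pure lambda-terms (with constants), eta-equality, and the essence. *)

datatype 'c lam = LConst 'c | LVar nat | LLam "'c lam" | LApp "'c lam" "'c lam"

primrec ren_lam :: "(nat \<Rightarrow> nat) \<Rightarrow> 'c lam \<Rightarrow> 'c lam" where
  "ren_lam \<xi> (LConst c) = LConst c"
| "ren_lam \<xi> (LVar n) = LVar (\<xi> n)"
| "ren_lam \<xi> (LLam M) = LLam (ren_lam (up_ren \<xi>) M)"
| "ren_lam \<xi> (LApp M N) = LApp (ren_lam \<xi> M) (ren_lam \<xi> N)"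

inductive eta :: "'c lam \<Rightarrow> 'c lam \<Rightarrow> bool" where
  eta: "eta (LLam (LApp (ren_lam Suc M) (LVar 0))) M"
| eta_lam: "eta M M' \<Longrightarrow> eta (LLam M) (LLam M')"
| eta_app1: "eta M M' \<Longrightarrow> eta (LApp M N) (LApp M' N)"
| eta_app2: "eta N N' \<Longrightarrow> eta (LApp M N) (LApp M N')"

definition eta_eq :: "'c lam \<Rightarrow> 'c lam \<Rightarrow> bool" where
  "eta_eq = equivclp eta"

fun ess :: "('a, 'c) obj \<Rightarrow> 'c lam" where
  "ess (Const c) = LConst c"
| "ess (Var n) = LVar n"
| "ess (Lam \<sigma> \<Delta>) = LLam (ess \<Delta>)"
| "ess (App \<Delta>1 \<Delta>2) = LApp (ess \<Delta>1) (ess \<Delta>2)"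
| "ess (RLam \<sigma> \<Delta>) = LLam (ess \<Delta>)"
| "ess (RApp \<Delta>1 \<Delta>2) = ess \<Delta>2"
| "ess (Pair \<Delta>1 \<Delta>2) = ess \<Delta>1"
| "ess (Copair \<Delta>1 \<Delta>2) = ess \<Delta>1"
| "ess (PrL \<Delta>) = ess \<Delta>"
| "ess (PrR \<Delta>) = ess \<Delta>"
| "ess (InL \<sigma> \<Delta>) = ess \<Delta>"
| "ess (InR \<sigma> \<Delta>) = ess \<Delta>"

(* Admissible pseudo-terms.  With strict = True, only those (co-)pairs are considered, at any
   depth, whose components have identical essences.  With strict = False, all (co-)pairs are
   pseudo-terms, and the eta-equality required by the typing rules is the only restriction. *)

primrec wf_fam :: "bool \<Rightarrow> ('a, 'c) fam \<Rightarrow> bool"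
  and wf_obj :: "bool \<Rightarrow> ('a, 'c) obj \<Rightarrow> bool" where
  "wf_fam strict (FConst a) \<longleftrightarrow> True"
| "wf_fam strict (FPi \<sigma> \<tau>) \<longleftrightarrow> wf_fam strict \<sigma> \<and> wf_fam strict \<tau>"
| "wf_fam strict (FApp \<sigma> \<Delta>) \<longleftrightarrow> wf_fam strict \<sigma> \<and> wf_obj strict \<Delta>"
| "wf_fam strict (FRel \<sigma> \<tau>) \<longleftrightarrow> wf_fam strict \<sigma> \<and> wf_fam strict \<tau>"
| "wf_fam strict (FInter \<sigma> \<tau>) \<longleftrightarrow> wf_fam strict \<sigma> \<and> wf_fam strict \<tau>"
| "wf_fam strict (FUnion \<sigma> \<tau>) \<longleftrightarrow> wf_fam strict \<sigma> \<and> wf_fam strict \<tau>"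
| "wf_obj strict (Const c) \<longleftrightarrow> True"
| "wf_obj strict (Var n) \<longleftrightarrow> True"
| "wf_obj strict (Lam \<sigma> \<Delta>) \<longleftrightarrow> wf_fam strict \<sigma> \<and> wf_obj strict \<Delta>"
| "wf_obj strict (App \<Delta>1 \<Delta>2) \<longleftrightarrow> wf_obj strict \<Delta>1 \<and> wf_obj strict \<Delta>2"
| "wf_obj strict (RLam \<sigma> \<Delta>) \<longleftrightarrow> wf_fam strict \<sigma> \<and> wf_obj strict \<Delta>"
| "wf_obj strict (RApp \<Delta>1 \<Delta>2) \<longleftrightarrow> wf_obj strict \<Delta>1 \<and> wf_obj strict \<Delta>2"
| "wf_obj strict (Pair \<Delta>1 \<Delta>2) \<longleftrightarrow>
     wf_obj strict \<Delta>1 \<and> wf_obj strict \<Delta>2 \<and> (strict \<longrightarrow> ess \<Delta>1 = ess \<Delta>2)"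
| "wf_obj strict (Copair \<Delta>1 \<Delta>2) \<longleftrightarrow>
     wf_obj strict \<Delta>1 \<and> wf_obj strict \<Delta>2 \<and> (strict \<longrightarrow> ess \<Delta>1 = ess \<Delta>2)"
| "wf_obj strict (PrL \<Delta>) \<longleftrightarrow> wf_obj strict \<Delta>"
| "wf_obj strict (PrR \<Delta>) \<longleftrightarrow> wf_obj strict \<Delta>"
| "wf_obj strict (InL \<sigma> \<Delta>) \<longleftrightarrow> wf_fam strict \<sigma> \<and> wf_obj strict \<Delta>"
| "wf_obj strict (InR \<sigma> \<Delta>) \<longleftrightarrow> wf_fam strict \<sigma> \<and> wf_obj strict \<Delta>"

primrec wf_kind :: "bool \<Rightarrow> ('a, 'c) kind \<Rightarrow> bool" where
  "wf_kind strict KType \<longleftrightarrow> True"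
| "wf_kind strict (KPi \<sigma> K) \<longleftrightarrow> wf_fam strict \<sigma> \<and> wf_kind strict K"

(* One-step reduction.  The two components of a (co-)pair are reduced simultaneously. *)

inductive red_fam :: "('a, 'c) fam \<Rightarrow> ('a, 'c) fam \<Rightarrow> bool"
  and red_obj :: "('a, 'c) obj \<Rightarrow> ('a, 'c) obj \<Rightarrow> bool" where
  beta: "red_obj (App (Lam \<sigma> \<Delta>1) \<Delta>2) (sub_obj (inst \<Delta>2) \<Delta>1)"
| prl_pair: "red_obj (PrL (Pair \<Delta>1 \<Delta>2)) \<Delta>1"
| prr_pair: "red_obj (PrR (Pair \<Delta>1 \<Delta>2)) \<Delta>2"
| copair_inl: "red_obj (App (Copair \<Delta>1 \<Delta>2) (InL \<sigma> \<Delta>3)) (App \<Delta>1 \<Delta>3)"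
| copair_inr: "red_obj (App (Copair \<Delta>1 \<Delta>2) (InR \<sigma> \<Delta>3)) (App \<Delta>2 \<Delta>3)"
| beta_rel: "red_obj (RApp (RLam \<sigma> \<Delta>1) \<Delta>2) (sub_obj (inst \<Delta>2) \<Delta>1)"
| lam1: "red_fam \<sigma> \<sigma>' \<Longrightarrow> red_obj (Lam \<sigma> \<Delta>) (Lam \<sigma>' \<Delta>)"
| lam2: "red_obj \<Delta> \<Delta>' \<Longrightarrow> red_obj (Lam \<sigma> \<Delta>) (Lam \<sigma> \<Delta>')"
| app1: "red_obj \<Delta>1 \<Delta>1' \<Longrightarrow> red_obj (App \<Delta>1 \<Delta>2) (App \<Delta>1' \<Delta>2)"
| app2: "red_obj \<Delta>2 \<Delta>2' \<Longrightarrow> red_obj (App \<Delta>1 \<Delta>2) (App \<Delta>1 \<Delta>2')"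
| rlam1: "red_fam \<sigma> \<sigma>' \<Longrightarrow> red_obj (RLam \<sigma> \<Delta>) (RLam \<sigma>' \<Delta>)"
| rlam2: "red_obj \<Delta> \<Delta>' \<Longrightarrow> red_obj (RLam \<sigma> \<Delta>) (RLam \<sigma> \<Delta>')"
| rapp1: "red_obj \<Delta>1 \<Delta>1' \<Longrightarrow> red_obj (RApp \<Delta>1 \<Delta>2) (RApp \<Delta>1' \<Delta>2)"
| rapp2: "red_obj \<Delta>2 \<Delta>2' \<Longrightarrow> red_obj (RApp \<Delta>1 \<Delta>2) (RApp \<Delta>1 \<Delta>2')"
| pair: "red_obj \<Delta>1 \<Delta>1' \<Longrightarrow> red_obj \<Delta>2 \<Delta>2' \<Longrightarrow> ess \<Delta>1' = ess \<Delta>2' \<Longrightarrow>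
    red_obj (Pair \<Delta>1 \<Delta>2) (Pair \<Delta>1' \<Delta>2')"
| copair: "red_obj \<Delta>1 \<Delta>1' \<Longrightarrow> red_obj \<Delta>2 \<Delta>2' \<Longrightarrow> ess \<Delta>1' = ess \<Delta>2' \<Longrightarrow>
    red_obj (Copair \<Delta>1 \<Delta>2) (Copair \<Delta>1' \<Delta>2')"
| prl: "red_obj \<Delta> \<Delta>' \<Longrightarrow> red_obj (PrL \<Delta>) (PrL \<Delta>')"
| prr: "red_obj \<Delta> \<Delta>' \<Longrightarrow> red_obj (PrR \<Delta>) (PrR \<Delta>')"
| inl1: "red_fam \<sigma> \<sigma>' \<Longrightarrow> red_obj (InL \<sigma> \<Delta>) (InL \<sigma>' \<Delta>)"
| inl2: "red_obj \<Delta> \<Delta>' \<Longrightarrow> red_obj (InL \<sigma> \<Delta>) (InL \<sigma> \<Delta>')"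
| inr1: "red_fam \<sigma> \<sigma>' \<Longrightarrow> red_obj (InR \<sigma> \<Delta>) (InR \<sigma>' \<Delta>)"
| inr2: "red_obj \<Delta> \<Delta>' \<Longrightarrow> red_obj (InR \<sigma> \<Delta>) (InR \<sigma> \<Delta>')"
| fpi1: "red_fam \<sigma> \<sigma>' \<Longrightarrow> red_fam (FPi \<sigma> \<tau>) (FPi \<sigma>' \<tau>)"
| fpi2: "red_fam \<tau> \<tau>' \<Longrightarrow> red_fam (FPi \<sigma> \<tau>) (FPi \<sigma> \<tau>')"
| fapp1: "red_fam \<sigma> \<sigma>' \<Longrightarrow> red_fam (FApp \<sigma> \<Delta>) (FApp \<sigma>' \<Delta>)"
| fapp2: "red_obj \<Delta> \<Delta>' \<Longrightarrow> red_fam (FApp \<sigma> \<Delta>) (FApp \<sigma> \<Delta>')"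
| frel1: "red_fam \<sigma> \<sigma>' \<Longrightarrow> red_fam (FRel \<sigma> \<tau>) (FRel \<sigma>' \<tau>)"
| frel2: "red_fam \<tau> \<tau>' \<Longrightarrow> red_fam (FRel \<sigma> \<tau>) (FRel \<sigma> \<tau>')"
| finter1: "red_fam \<sigma> \<sigma>' \<Longrightarrow> red_fam (FInter \<sigma> \<tau>) (FInter \<sigma>' \<tau>)"
| finter2: "red_fam \<tau> \<tau>' \<Longrightarrow> red_fam (FInter \<sigma> \<tau>) (FInter \<sigma> \<tau>')"
| funion1: "red_fam \<sigma> \<sigma>' \<Longrightarrow> red_fam (FUnion \<sigma> \<tau>) (FUnion \<sigma>' \<tau>)"
| funion2: "red_fam \<tau> \<tau>' \<Longrightarrow> red_fam (FUnion \<sigma> \<tau>) (FUnion \<sigma> \<tau>')"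

inductive red_kind :: "('a, 'c) kind \<Rightarrow> ('a, 'c) kind \<Rightarrow> bool" where
  kpi1: "red_fam \<sigma> \<sigma>' \<Longrightarrow> red_kind (KPi \<sigma> K) (KPi \<sigma>' K)"
| kpi2: "red_kind K K' \<Longrightarrow> red_kind (KPi \<sigma> K) (KPi \<sigma> K')"

(* Delta-equality: the equivalence closure of reduction on admissible pseudo-terms. *)

definition conv_fam :: "bool \<Rightarrow> ('a, 'c) fam \<Rightarrow> ('a, 'c) fam \<Rightarrow> bool" where
  "conv_fam strict = equivclp (\<lambda>\<sigma> \<tau>. wf_fam strict \<sigma> \<and> wf_fam strict \<tau> \<and> red_fam \<sigma> \<tau>)"

definition conv_kind :: "bool \<Rightarrow> ('a, 'c) kind \<Rightarrow> ('a, 'c) kind \<Rightarrow> bool" where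
  "conv_kind strict = equivclp (\<lambda>K L. wf_kind strict K \<and> wf_kind strict L \<and> red_kind K L)"

(* Signatures and contexts are lists with the most recent declaration first; the entry at
   position i of a context is a family over the entries after it. *)

datatype ('a, 'c) decl = FamDecl 'a "('a, 'c) kind" | ObjDecl 'c "('a, 'c) fam"

type_synonym ('a, 'c) sig = "('a, 'c) decl list"
type_synonym ('a, 'c) ctx = "('a, 'c) fam list"

(* The judgements  |- Sigma,  |-_Sigma Gamma,  Gamma |-_Sigma K,  Gamma |-_Sigma sigma : K
   and Gamma |-_Sigma Delta : sigma.  Freshness of context variables is automatic with
   de Bruijn indices, and declared kinds and types are closed, so they need no lifting.

   In rlam, the type tau is shared by the premise (context Gamma, x:sigma) and the conclusion
   (context Gamma).  It is therefore required to be free of x and to make the relevant arrow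
   a well-formed family of Gamma, in the same way as in inl and inr.
   In pair and copair, the condition on strict expresses that the subject is an admissible
   pseudo-term; all other rules only produce admissible pseudo-terms from such. *)

inductive sig_ok :: "bool \<Rightarrow> ('a, 'c) sig \<Rightarrow> bool"
  and ctx_ok :: "bool \<Rightarrow> ('a, 'c) sig \<Rightarrow> ('a, 'c) ctx \<Rightarrow> bool"
  and kind_ok :: "bool \<Rightarrow> ('a, 'c) sig \<Rightarrow> ('a, 'c) ctx \<Rightarrow> ('a, 'c) kind \<Rightarrow> bool"
  and fam_has :: "bool \<Rightarrow> ('a, 'c) sig \<Rightarrow> ('a, 'c) ctx \<Rightarrow> ('a, 'c) fam \<Rightarrow> ('a, 'c) kind \<Rightarrow> bool"
  and obj_has :: "bool \<Rightarrow> ('a, 'c) sig \<Rightarrow> ('a, 'c) ctx \<Rightarrow> ('a, 'c) obj \<Rightarrow> ('a, 'c) fam \<Rightarrow> bool"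
  for strict :: bool
where
  sig_empty: "sig_ok strict []"
| sig_fam: "sig_ok strict \<Sigma> \<Longrightarrow> kind_ok strict \<Sigma> [] K \<Longrightarrow> (\<forall>L. FamDecl a L \<notin> set \<Sigma>) \<Longrightarrow>
    sig_ok strict (FamDecl a K # \<Sigma>)"
| sig_obj: "sig_ok strict \<Sigma> \<Longrightarrow> fam_has strict \<Sigma> [] \<sigma> KType \<Longrightarrow> (\<forall>\<tau>. ObjDecl c \<tau> \<notin> set \<Sigma>) \<Longrightarrow>
    sig_ok strict (ObjDecl c \<sigma> # \<Sigma>)"

| ctx_empty: "sig_ok strict \<Sigma> \<Longrightarrow> ctx_ok strict \<Sigma> []"
| ctx_var: "ctx_ok strict \<Sigma> \<Gamma> \<Longrightarrow> fam_has strict \<Sigma> \<Gamma> \<sigma> KType \<Longrightarrow> ctx_ok strict \<Sigma> (\<sigma> # \<Gamma>)"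

| kind_type: "ctx_ok strict \<Sigma> \<Gamma> \<Longrightarrow> kind_ok strict \<Sigma> \<Gamma> KType"
| kind_pi: "kind_ok strict \<Sigma> (\<sigma> # \<Gamma>) K \<Longrightarrow> kind_ok strict \<Sigma> \<Gamma> (KPi \<sigma> K)"

| fam_const: "ctx_ok strict \<Sigma> \<Gamma> \<Longrightarrow> FamDecl a K \<in> set \<Sigma> \<Longrightarrow> fam_has strict \<Sigma> \<Gamma> (FConst a) K"
| fam_pi: "fam_has strict \<Sigma> (\<sigma> # \<Gamma>) \<tau> KType \<Longrightarrow> fam_has strict \<Sigma> \<Gamma> (FPi \<sigma> \<tau>) KType"
| fam_app: "fam_has strict \<Sigma> \<Gamma> \<sigma> (KPi \<tau> K) \<Longrightarrow> obj_has strict \<Sigma> \<Gamma> \<Delta> \<tau> \<Longrightarrow>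
    fam_has strict \<Sigma> \<Gamma> (FApp \<sigma> \<Delta>) (sub_kind (inst \<Delta>) K)"
| fam_rel: "fam_has strict \<Sigma> \<Gamma> \<sigma> KType \<Longrightarrow> fam_has strict \<Sigma> \<Gamma> \<tau> KType \<Longrightarrow>
    fam_has strict \<Sigma> \<Gamma> (FRel \<sigma> \<tau>) KType"
| fam_inter: "fam_has strict \<Sigma> \<Gamma> \<sigma> KType \<Longrightarrow> fam_has strict \<Sigma> \<Gamma> \<tau> KType \<Longrightarrow>
    fam_has strict \<Sigma> \<Gamma> (FInter \<sigma> \<tau>) KType"
| fam_union: "fam_has strict \<Sigma> \<Gamma> \<sigma> KType \<Longrightarrow> fam_has strict \<Sigma> \<Gamma> \<tau> KType \<Longrightarrow>
    fam_has strict \<Sigma> \<Gamma> (FUnion \<sigma> \<tau>) KType"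
| fam_conv: "fam_has strict \<Sigma> \<Gamma> \<sigma> K1 \<Longrightarrow> kind_ok strict \<Sigma> \<Gamma> K2 \<Longrightarrow> conv_kind strict K1 K2 \<Longrightarrow>
    fam_has strict \<Sigma> \<Gamma> \<sigma> K2"

| obj_const: "ctx_ok strict \<Sigma> \<Gamma> \<Longrightarrow> ObjDecl c \<sigma> \<in> set \<Sigma> \<Longrightarrow> obj_has strict \<Sigma> \<Gamma> (Const c) \<sigma>"
| obj_var: "ctx_ok strict \<Sigma> \<Gamma> \<Longrightarrow> i < length \<Gamma> \<Longrightarrow>
    obj_has strict \<Sigma> \<Gamma> (Var i) (ren_fam (\<lambda>n. n + Suc i) (\<Gamma> ! i))"
| obj_lam: "obj_has strict \<Sigma> (\<sigma> # \<Gamma>) \<Delta> \<tau> \<Longrightarrow> obj_has strict \<Sigma> \<Gamma> (Lam \<sigma> \<Delta>) (FPi \<sigma> \<tau>)"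
| obj_app: "obj_has strict \<Sigma> \<Gamma> \<Delta>1 (FPi \<sigma> \<tau>) \<Longrightarrow> obj_has strict \<Sigma> \<Gamma> \<Delta>2 \<sigma> \<Longrightarrow>
    obj_has strict \<Sigma> \<Gamma> (App \<Delta>1 \<Delta>2) (sub_fam (inst \<Delta>2) \<tau>)"
| obj_rlam: "obj_has strict \<Sigma> (\<sigma> # \<Gamma>) \<Delta> (ren_fam Suc \<tau>) \<Longrightarrow> eta_eq (ess \<Delta>) (LVar 0) \<Longrightarrow>
    fam_has strict \<Sigma> \<Gamma> (FRel \<sigma> \<tau>) KType \<Longrightarrow>
    obj_has strict \<Sigma> \<Gamma> (RLam \<sigma> \<Delta>) (FRel \<sigma> \<tau>)"
| obj_rapp: "obj_has strict \<Sigma> \<Gamma> \<Delta>1 (FRel \<sigma> \<tau>) \<Longrightarrow> obj_has strict \<Sigma> \<Gamma> \<Delta>2 \<sigma> \<Longrightarrow>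
    obj_has strict \<Sigma> \<Gamma> (RApp \<Delta>1 \<Delta>2) \<tau>"
| obj_pair: "obj_has strict \<Sigma> \<Gamma> \<Delta>1 \<sigma> \<Longrightarrow> obj_has strict \<Sigma> \<Gamma> \<Delta>2 \<tau> \<Longrightarrow>
    eta_eq (ess \<Delta>1) (ess \<Delta>2) \<Longrightarrow> (strict \<longrightarrow> ess \<Delta>1 = ess \<Delta>2) \<Longrightarrow>
    obj_has strict \<Sigma> \<Gamma> (Pair \<Delta>1 \<Delta>2) (FInter \<sigma> \<tau>)"
| obj_prl: "obj_has strict \<Sigma> \<Gamma> \<Delta> (FInter \<sigma> \<tau>) \<Longrightarrow> obj_has strict \<Sigma> \<Gamma> (PrL \<Delta>) \<sigma>"
| obj_prr: "obj_has strict \<Sigma> \<Gamma> \<Delta> (FInter \<sigma> \<tau>) \<Longrightarrow> obj_has strict \<Sigma> \<Gamma> (PrR \<Delta>) \<tau>"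
| obj_inl: "obj_has strict \<Sigma> \<Gamma> \<Delta> \<sigma> \<Longrightarrow> fam_has strict \<Sigma> \<Gamma> (FUnion \<sigma> \<tau>) KType \<Longrightarrow>
    obj_has strict \<Sigma> \<Gamma> (InL \<tau> \<Delta>) (FUnion \<sigma> \<tau>)"
| obj_inr: "obj_has strict \<Sigma> \<Gamma> \<Delta> \<tau> \<Longrightarrow> fam_has strict \<Sigma> \<Gamma> (FUnion \<sigma> \<tau>) KType \<Longrightarrow>
    obj_has strict \<Sigma> \<Gamma> (InR \<sigma> \<Delta>) (FUnion \<sigma> \<tau>)"
| obj_copair: "obj_has strict \<Sigma> \<Gamma> \<Delta>1 (FPi \<sigma> (sub_fam (repl (InL (ren_fam Suc \<tau>) (Var 0))) \<rho>)) \<Longrightarrow>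
    obj_has strict \<Sigma> \<Gamma> \<Delta>2 (FPi \<tau> (sub_fam (repl (InR (ren_fam Suc \<sigma>) (Var 0))) \<rho>)) \<Longrightarrow>
    eta_eq (ess \<Delta>1) (ess \<Delta>2) \<Longrightarrow> (strict \<longrightarrow> ess \<Delta>1 = ess \<Delta>2) \<Longrightarrow>
    fam_has strict \<Sigma> (FUnion \<sigma> \<tau> # \<Gamma>) \<rho> KType \<Longrightarrow>
    obj_has strict \<Sigma> \<Gamma> (Copair \<Delta>1 \<Delta>2) (FPi (FUnion \<sigma> \<tau>) \<rho>)"
| obj_conv: "obj_has strict \<Sigma> \<Gamma> \<Delta> \<sigma> \<Longrightarrow> fam_has strict \<Sigma> \<Gamma> \<tau> KType \<Longrightarrow> conv_fam strict \<sigma> \<tau> \<Longrightarrow>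
    obj_has strict \<Sigma> \<Gamma> \<Delta> \<tau>"

end

theory Submission
  imports Defs
begin

text \<open>
  Confluence is not needed (and fails, because the components of a pair reduce in lockstep):
  families have no redex at the head, so conversion of products, relevant arrows, intersections and
  unions is injective by inspection of a conversion chain.  For the relevant abstraction one has to
  see that the essence of the body stays eta-equal to the bound variable.  A reduction step on a
  typed object changes the essence by an eta-equality or by one beta step, and beta steps preserve
  eta-equality to a variable because beta commutes with eta.
\<close>

section \<open>Substitution calculus\<close>

text \<open>Among the side conditions on essences only the one of \<open>RLam\<close> is delicate.
  Reduction of pairs and co-pairs carries the identity of the reduct essences as a premise, so their
  conditions are restored at once, whereas an arbitrary step in the body of \<open>RLam\<close> has
  to keep its essence eta-equal to index 0. Without typing this is hopeless: contracting
  \<open>RApp (RLam \<sigma> \<Delta>1) \<Delta>2\<close> could replace the essence of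
  \<open>\<Delta>2\<close> by an unrelated term. The analysis of essences therefore rests on
  generation, and since it refers to the typing of the unreduced object only, it does not presuppose
  subject reduction.

  A second obstacle is that conversion runs through admissible pseudo-terms only. A chain may leave
  the typable terms but never the admissible ones, so the lemmas on conversion track
  \<open>wf_fam\<close>, \<open>wf_obj\<close> and \<open>wf_kind\<close>, and typing is shown to
  imply admissibility.\<close>

lemma up_ren_simps [simp]: "up_ren \<xi> 0 = 0" "up_ren \<xi> (Suc n) = Suc (\<xi> n)"
  by (simp_all add: up_ren_def)

lemma up_sub_simps [simp]: "up_sub \<theta> 0 = Var 0" "up_sub \<theta> (Suc n) = ren_obj Suc (\<theta> n)"
  by (simp_all add: up_sub_def)

lemma inst_simps [simp]: "inst \<Delta> 0 = \<Delta>" "inst \<Delta> (Suc n) = Var n"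
  by (simp_all add: inst_def)

lemma repl_simps [simp]: "repl \<Delta> 0 = \<Delta>" "repl \<Delta> (Suc n) = Var (Suc n)"
  by (simp_all add: repl_def)

lemma nat_fun_eqI:
  assumes "f 0 = g 0" "\<And>n. f (Suc n) = g (Suc n)"
  shows "f = g"
proof
  show "f n = g n" for n
    using assms by (cases n) auto
qed

lemma up_ren_comp: "up_ren \<xi> \<circ> up_ren \<zeta> = up_ren (\<xi> \<circ> \<zeta>)"
  by (rule nat_fun_eqI) simp_all

lemma up_sub_comp_ren: "up_sub \<theta> \<circ> up_ren \<xi> = up_sub (\<theta> \<circ> \<xi>)"
  by (rule nat_fun_eqI) simp_all

lemma up_sub_Var: "up_sub (Var \<circ> \<xi>) = Var \<circ> up_ren \<xi>"
  by (rule nat_fun_eqI) simp_all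

lemma up_sub_Var_id [simp]: "up_sub Var = Var"
  by (rule nat_fun_eqI) simp_all

lemma sub_Var [simp]:
  fixes \<sigma> :: "('a, 'c) fam" and \<Delta> :: "('a, 'c) obj"
  shows "sub_fam Var \<sigma> = \<sigma>" "sub_obj Var \<Delta> = \<Delta>"
  by (induction \<sigma> and \<Delta>) simp_all

lemma sub_kind_Var [simp]: "sub_kind Var K = K"
  by (induction K) simp_all

text \<open>Lets facts proved for substitutions, such as stability of reduction and conversion, be
  reused for renamings.\<close>

lemma ren_eq_sub:
  fixes \<sigma> :: "('a, 'c) fam" and \<Delta> :: "('a, 'c) obj"
  shows "ren_fam \<xi> \<sigma> = sub_fam (Var \<circ> \<xi>) \<sigma>" "ren_obj \<xi> \<Delta> = sub_obj (Var \<circ> \<xi>) \<Delta>"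
  by (induction \<sigma> and \<Delta> arbitrary: \<xi> and \<xi>) (simp_all add: up_sub_Var)

text \<open>The composition laws build on one another: under a binder, renaming after substitution
  needs \<open>ren_ren\<close>, and substitution after substitution needs both mixed laws.\<close>

lemma ren_ren:
  fixes \<sigma> :: "('a, 'c) fam" and \<Delta> :: "('a, 'c) obj"
  shows "ren_fam \<xi> (ren_fam \<zeta> \<sigma>) = ren_fam (\<xi> \<circ> \<zeta>) \<sigma>"
    "ren_obj \<xi> (ren_obj \<zeta> \<Delta>) = ren_obj (\<xi> \<circ> \<zeta>) \<Delta>"
  by (induction \<sigma> and \<Delta> arbitrary: \<xi> \<zeta> and \<xi> \<zeta>) (simp_all add: up_ren_comp)

lemma sub_ren:
  fixes \<sigma> :: "('a, 'c) fam" and \<Delta> :: "('a, 'c) obj"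
  shows "sub_fam \<theta> (ren_fam \<xi> \<sigma>) = sub_fam (\<theta> \<circ> \<xi>) \<sigma>"
    "sub_obj \<theta> (ren_obj \<xi> \<Delta>) = sub_obj (\<theta> \<circ> \<xi>) \<Delta>"
  by (induction \<sigma> and \<Delta> arbitrary: \<theta> \<xi> and \<theta> \<xi>) (simp_all add: up_sub_comp_ren)

lemma ren_comp_up_sub: "ren_obj (up_ren \<xi>) \<circ> up_sub \<theta> = up_sub (ren_obj \<xi> \<circ> \<theta>)"
  by (rule nat_fun_eqI) (simp_all add: ren_ren comp_def)

lemma ren_sub:
  fixes \<sigma> :: "('a, 'c) fam" and \<Delta> :: "('a, 'c) obj"
  shows "ren_fam \<xi> (sub_fam \<theta> \<sigma>) = sub_fam (ren_obj \<xi> \<circ> \<theta>) \<sigma>"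
    "ren_obj \<xi> (sub_obj \<theta> \<Delta>) = sub_obj (ren_obj \<xi> \<circ> \<theta>) \<Delta>"
  by (induction \<sigma> and \<Delta> arbitrary: \<theta> \<xi> and \<theta> \<xi>) (simp_all add: ren_comp_up_sub)

lemma sub_comp_up_sub: "sub_obj (up_sub \<theta>) \<circ> up_sub \<eta> = up_sub (sub_obj \<theta> \<circ> \<eta>)"
  by (rule nat_fun_eqI) (simp_all add: sub_ren ren_sub comp_def)

lemma sub_sub:
  fixes \<sigma> :: "('a, 'c) fam" and \<Delta> :: "('a, 'c) obj"
  shows "sub_fam \<theta> (sub_fam \<eta> \<sigma>) = sub_fam (sub_obj \<theta> \<circ> \<eta>) \<sigma>"
    "sub_obj \<theta> (sub_obj \<eta> \<Delta>) = sub_obj (sub_obj \<theta> \<circ> \<eta>) \<Delta>"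
  by (induction \<sigma> and \<Delta> arbitrary: \<theta> \<eta> and \<theta> \<eta>) (simp_all add: sub_comp_up_sub)

lemma sub_kind_sub_kind: "sub_kind \<theta> (sub_kind \<eta> K) = sub_kind (sub_obj \<theta> \<circ> \<eta>) K"
  by (induction K arbitrary: \<theta> \<eta>) (simp_all add: sub_comp_up_sub sub_sub)

lemma inst_comp_Suc [simp]: "inst \<Delta> \<circ> Suc = Var"
  by (simp add: fun_eq_iff)

lemma sub_inst_ren_Suc [simp]:
  "sub_fam (inst \<Delta>) (ren_fam Suc \<sigma>) = \<sigma>" "sub_obj (inst \<Delta>) (ren_obj Suc \<Delta>') = \<Delta>'"
  by (simp_all add: sub_ren)

lemma sub_up_ren_Suc:
  "sub_fam (up_sub \<theta>) (ren_fam Suc \<sigma>) = ren_fam Suc (sub_fam \<theta> \<sigma>)"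
  "sub_obj (up_sub \<theta>) (ren_obj Suc \<Delta>) = ren_obj Suc (sub_obj \<theta> \<Delta>)"
  by (simp_all add: sub_ren ren_sub comp_def)

lemma sub_comp_inst: "sub_obj \<theta> \<circ> inst \<Delta> = sub_obj (inst (sub_obj \<theta> \<Delta>)) \<circ> up_sub \<theta>"
  by (rule nat_fun_eqI) simp_all

lemma sub_inst:
  "sub_fam \<theta> (sub_fam (inst \<Delta>) \<sigma>) = sub_fam (inst (sub_obj \<theta> \<Delta>)) (sub_fam (up_sub \<theta>) \<sigma>)"
  "sub_obj \<theta> (sub_obj (inst \<Delta>) \<Delta>') = sub_obj (inst (sub_obj \<theta> \<Delta>)) (sub_obj (up_sub \<theta>) \<Delta>')"
  "sub_kind \<theta> (sub_kind (inst \<Delta>) K) = sub_kind (inst (sub_obj \<theta> \<Delta>)) (sub_kind (up_sub \<theta>) K)"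
  by (simp_all only: sub_sub sub_kind_sub_kind sub_comp_inst)

text \<open>Makes the co-pair rule stable under substitution, since its branches have types of the
  form \<open>sub_fam (repl _) \<rho>\<close>. The two sides agree because \<open>repl\<close> fixes
  all successor indices, and lifted terms mention no others.\<close>

lemma sub_repl:
  assumes "sub_obj (up_sub \<theta>) \<Delta> = \<Delta>'"
  shows "sub_fam (up_sub \<theta>) (sub_fam (repl \<Delta>) \<rho>) = sub_fam (repl \<Delta>') (sub_fam (up_sub \<theta>) \<rho>)"
proof -
  have "repl \<Delta>' \<circ> Suc = Var \<circ> Suc"
    by (simp add: fun_eq_iff)
  then have *: "sub_obj (repl \<Delta>') (ren_obj Suc \<Delta>'') = ren_obj Suc \<Delta>''" for \<Delta>''
    by (metis sub_ren(2) ren_eq_sub(2))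
  have "sub_obj (up_sub \<theta>) \<circ> repl \<Delta> = sub_obj (repl \<Delta>') \<circ> up_sub \<theta>"
    by (rule nat_fun_eqI) (simp_all add: assms *)
  then show ?thesis
    by (simp add: sub_sub)
qed

text \<open>Computes the type of a co-pair branch applied to an argument: the motive
  \<open>\<rho>\<close> at the injected argument.\<close>

lemma sub_inst_repl: "sub_fam (inst \<Delta>) (sub_fam (repl \<Delta>') \<rho>) = sub_fam (inst (sub_obj (inst \<Delta>) \<Delta>')) \<rho>"
proof -
  have "sub_obj (inst \<Delta>) \<circ> repl \<Delta>' = inst (sub_obj (inst \<Delta>) \<Delta>')"
    by (rule nat_fun_eqI) simp_all
  then show ?thesis
    by (simp add: sub_sub)
qed

section \<open>Beta and eta reduction of essences\<close>

definition up_lam :: "(nat \<Rightarrow> 'c lam) \<Rightarrow> nat \<Rightarrow> 'c lam" where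
  "up_lam \<theta> = case_nat (LVar 0) (\<lambda>n. ren_lam Suc (\<theta> n))"

primrec sub_lam :: "(nat \<Rightarrow> 'c lam) \<Rightarrow> 'c lam \<Rightarrow> 'c lam" where
  "sub_lam \<theta> (LConst c) = LConst c"
| "sub_lam \<theta> (LVar n) = \<theta> n"
| "sub_lam \<theta> (LLam M) = LLam (sub_lam (up_lam \<theta>) M)"
| "sub_lam \<theta> (LApp M N) = LApp (sub_lam \<theta> M) (sub_lam \<theta> N)"

definition inst_lam :: "'c lam \<Rightarrow> nat \<Rightarrow> 'c lam" where
  "inst_lam M = case_nat M LVar"

text \<open>Ordinary beta reduction of pure terms: the effect on essences of contracting a
  \<open>Lam\<close> redex.\<close>

inductive beta_lam :: "'c lam \<Rightarrow> 'c lam \<Rightarrow> bool" where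
  beta: "beta_lam (LApp (LLam M) N) (sub_lam (inst_lam N) M)"
| lam: "beta_lam M M' \<Longrightarrow> beta_lam (LLam M) (LLam M')"
| app1: "beta_lam M M' \<Longrightarrow> beta_lam (LApp M N) (LApp M' N)"
| app2: "beta_lam N N' \<Longrightarrow> beta_lam (LApp M N) (LApp M N')"

lemma up_lam_simps [simp]: "up_lam \<theta> 0 = LVar 0" "up_lam \<theta> (Suc n) = ren_lam Suc (\<theta> n)"
  by (simp_all add: up_lam_def)

lemma inst_lam_simps [simp]: "inst_lam M 0 = M" "inst_lam M (Suc n) = LVar n"
  by (simp_all add: inst_lam_def)

lemma up_lam_LVar [simp]: "up_lam LVar = LVar"
  by (rule nat_fun_eqI) simp_all

lemma sub_lam_LVar [simp]: "sub_lam LVar M = M"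
  by (induction M) simp_all

lemma up_lam_comp_ren: "up_lam \<theta> \<circ> up_ren \<xi> = up_lam (\<theta> \<circ> \<xi>)"
  by (rule nat_fun_eqI) simp_all

lemma ren_lam_ren_lam: "ren_lam \<xi> (ren_lam \<zeta> M) = ren_lam (\<xi> \<circ> \<zeta>) M"
  by (induction M arbitrary: \<xi> \<zeta>) (simp_all add: up_ren_comp)

lemma sub_lam_ren_lam: "sub_lam \<theta> (ren_lam \<xi> M) = sub_lam (\<theta> \<circ> \<xi>) M"
  by (induction M arbitrary: \<theta> \<xi>) (simp_all add: up_lam_comp_ren)

lemma ren_lam_comp_up_lam: "ren_lam (up_ren \<xi>) \<circ> up_lam \<theta> = up_lam (ren_lam \<xi> \<circ> \<theta>)"
  by (rule nat_fun_eqI) (simp_all add: ren_lam_ren_lam comp_def)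

lemma ren_lam_sub_lam: "ren_lam \<xi> (sub_lam \<theta> M) = sub_lam (ren_lam \<xi> \<circ> \<theta>) M"
  by (induction M arbitrary: \<theta> \<xi>) (simp_all add: ren_lam_comp_up_lam)

lemma inst_lam_comp_Suc [simp]: "inst_lam M \<circ> Suc = LVar"
  by (simp add: fun_eq_iff)

lemma sub_inst_lam_ren_Suc [simp]: "sub_lam (inst_lam N) (ren_lam Suc M) = M"
  by (simp add: sub_lam_ren_lam)

lemma sub_up_lam_ren_Suc: "sub_lam (up_lam \<theta>) (ren_lam Suc M) = ren_lam Suc (sub_lam \<theta> M)"
  by (simp add: sub_lam_ren_lam ren_lam_sub_lam comp_def)

lemma ren_up_lam_ren_Suc: "ren_lam (up_ren \<xi>) (ren_lam Suc M) = ren_lam Suc (ren_lam \<xi> M)"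
  by (simp add: ren_lam_ren_lam comp_def)

lemma ren_lam_Suc_inject [simp]: "ren_lam Suc M = ren_lam Suc N \<longleftrightarrow> M = N"
  by (metis sub_inst_lam_ren_Suc)

lemma ren_lam_inst: "ren_lam \<xi> (sub_lam (inst_lam N) M) = sub_lam (inst_lam (ren_lam \<xi> N)) (ren_lam (up_ren \<xi>) M)"
proof -
  have "ren_lam \<xi> \<circ> inst_lam N = inst_lam (ren_lam \<xi> N) \<circ> up_ren \<xi>"
    by (rule nat_fun_eqI) simp_all
  then show ?thesis
    by (simp add: ren_lam_sub_lam sub_lam_ren_lam)
qed

section \<open>Strengthening, and reflection of steps along renamings\<close>

primrec fv_lam :: "'c lam \<Rightarrow> nat set" where
  "fv_lam (LConst c) = {}"
| "fv_lam (LVar n) = {n}"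
| "fv_lam (LLam M) = {n. Suc n \<in> fv_lam M}"
| "fv_lam (LApp M N) = fv_lam M \<union> fv_lam N"

lemma fv_lam_ren_lam: "fv_lam (ren_lam \<xi> M) = \<xi> ` fv_lam M"
proof (induction M arbitrary: \<xi>)
  case (LLam M)
  have "Suc n \<in> up_ren \<xi> ` fv_lam M \<longleftrightarrow> (\<exists>m. Suc m \<in> fv_lam M \<and> n = \<xi> m)" for n
    unfolding image_iff by (metis Suc_inject nat.distinct(1) not0_implies_Suc up_ren_simps)
  then show ?case
    using LLam by auto
qed auto

lemma ren_lam_cong: "(\<And>n. n \<in> fv_lam M \<Longrightarrow> \<xi> n = n) \<Longrightarrow> ren_lam \<xi> M = M"
proof (induction M arbitrary: \<xi>)
  case (LLam M)
  have "up_ren \<xi> n = n" if "n \<in> fv_lam M" for n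
    using that LLam.prems by (cases n) auto
  then show ?case
    using LLam.IH by simp
qed auto

text \<open>A lifted renaming sends only index 0 to 0, so if the renamed term avoids index 0, then
  so does \<open>M\<close>, and \<open>M\<close> is itself lifted. This recognises the head of an
  eta-redex from its renamed image.\<close>

lemma ren_lam_up_eq_ren_lam_Suc:
  assumes "ren_lam (up_ren \<xi>) M = ren_lam Suc P"
  obtains N where "M = ren_lam Suc N" "P = ren_lam \<xi> N"
proof -
  have "up_ren \<xi> ` fv_lam M = Suc ` fv_lam P"
    by (metis assms fv_lam_ren_lam)
  then have "0 \<notin> fv_lam M"
    by (metis imageE image_eqI nat.distinct(1) up_ren_simps(1))
  \<comment> \<open>Truncated subtraction sends 0 to 0, so \<open>Suc (n - 1) = n\<close> fails at 0
    alone, an index that \<open>M\<close> avoids.\<close>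
  then have "ren_lam (Suc \<circ> (\<lambda>n. n - 1)) M = M"
    by (intro ren_lam_cong) (metis Suc_diff_1 comp_apply gr0I)
  then have M: "M = ren_lam Suc (ren_lam (\<lambda>n. n - 1) M)"
    by (simp add: ren_lam_ren_lam)
  then have "ren_lam Suc P = ren_lam Suc (ren_lam \<xi> (ren_lam (\<lambda>n. n - 1) M))"
    using assms by (metis ren_up_lam_ren_Suc)
  with M that show thesis
    by simp
qed

lemma eta_sub_lam: "eta M N \<Longrightarrow> eta (sub_lam \<theta> M) (sub_lam \<theta> N)"
  by (induction arbitrary: \<theta> rule: eta.induct) (auto simp: sub_up_lam_ren_Suc intro: eta.intros)

inductive_cases eta_LConstE: "eta (LConst c) N"
inductive_cases eta_LVarE: "eta (LVar n) N"
inductive_cases eta_LLamE: "eta (LLam M) N"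
inductive_cases eta_LAppE: "eta (LApp M1 M2) N"
inductive_cases beta_LConstE: "beta_lam (LConst c) N"
inductive_cases beta_LVarE: "beta_lam (LVar n) N"
inductive_cases beta_LLamE: "beta_lam (LLam M) N"

lemma eta_ren_lam: "eta M N \<Longrightarrow> eta (ren_lam \<xi> M) (ren_lam \<xi> N)"
  by (induction arbitrary: \<xi> rule: eta.induct) (auto simp: ren_up_lam_ren_Suc intro: eta.intros)

text \<open>A step inside the lifted head of an eta-redex is the image of a step of the unlifted
  head. The bound variable of a redex is recognised in the preimage because
  \<open>up_ren \<xi>\<close> maps no successor to 0.\<close>

lemma eta_ren_lamE:
  assumes "eta (ren_lam \<xi> M) N"
  shows "\<exists>N'. N = ren_lam \<xi> N' \<and> eta M N'"
  using assms
proof (induction M arbitrary: \<xi> N)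
  case (LLam M)
  from LLam.prems have "eta (LLam (ren_lam (up_ren \<xi>) M)) N"
    by simp
  then show ?case
  proof cases
    case eta
    then obtain A B where M: "M = LApp A B" "ren_lam (up_ren \<xi>) A = ren_lam Suc N"
      "ren_lam (up_ren \<xi>) B = LVar 0"
      by (cases M) auto
    moreover from M(3) have "B = LVar 0"
      by (cases B) (auto simp: up_ren_def split: nat.splits)
    ultimately show ?thesis
      by (metis ren_lam_up_eq_ren_lam_Suc eta.eta)
  next
    case (eta_lam M')
    then show ?thesis
      using LLam.IH by (metis eta.eta_lam ren_lam.simps(3))
  qed
next
  case (LApp M1 M2)
  from LApp.prems have "eta (LApp (ren_lam \<xi> M1) (ren_lam \<xi> M2)) N"
    by simp
  then show ?case
    by cases (metis LApp.IH eta.intros ren_lam.simps(4))+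
qed (auto elim: eta_LConstE eta_LVarE)

lemma beta_ren_lamE:
  assumes "beta_lam (ren_lam \<xi> M) N"
  shows "\<exists>N'. N = ren_lam \<xi> N' \<and> beta_lam M N'"
  using assms
proof (induction M arbitrary: \<xi> N)
  case (LLam M)
  then show ?case
    by (auto elim!: beta_LLamE) (metis beta_lam.lam ren_lam.simps(3))
next
  case (LApp M1 M2)
  from LApp.prems have "beta_lam (LApp (ren_lam \<xi> M1) (ren_lam \<xi> M2)) N"
    by simp
  then show ?case
  proof cases
    case (beta M)
    then obtain A where "M1 = LLam A" "M = ren_lam (up_ren \<xi>) A"
      by (cases M1) auto
    with beta show ?thesis
      by (metis beta_lam.beta ren_lam_inst)
  qed (metis LApp.IH beta_lam.intros ren_lam.simps(4))+
qed (auto elim: beta_LConstE beta_LVarE)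

section \<open>Confluence of eta, its commutation with beta, and eta-equality to a variable\<close>

lemma eta_rtranclp_cong:
  "eta\<^sup>*\<^sup>* M M' \<Longrightarrow> eta\<^sup>*\<^sup>* (LLam M) (LLam M')"
  "eta\<^sup>*\<^sup>* M M' \<Longrightarrow> eta\<^sup>*\<^sup>* (LApp M N) (LApp M' N)"
  "eta\<^sup>*\<^sup>* N N' \<Longrightarrow> eta\<^sup>*\<^sup>* (LApp M N) (LApp M N')"
  "eta\<^sup>*\<^sup>* M M' \<Longrightarrow> eta\<^sup>*\<^sup>* (ren_lam \<xi> M) (ren_lam \<xi> M')"
  by (induction rule: rtranclp_induct; blast intro: eta.intros eta_ren_lam rtranclp.rtrancl_into_rtrancl)+

text \<open>Even one step in a substituted term becomes many here, as its variable may occur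
  repeatedly in \<open>M\<close>.\<close>

lemma eta_sub_lam_arg:
  assumes "\<And>n. eta\<^sup>*\<^sup>* (\<theta> n) (\<theta>' n)"
  shows "eta\<^sup>*\<^sup>* (sub_lam \<theta> M) (sub_lam \<theta>' M)"
  using assms
proof (induction M arbitrary: \<theta> \<theta>')
  case (LLam M)
  have "eta\<^sup>*\<^sup>* (up_lam \<theta> n) (up_lam \<theta>' n)" for n
    using LLam.prems by (cases n) (auto intro: eta_rtranclp_cong)
  then show ?case
    using LLam.IH by (simp add: eta_rtranclp_cong)
next
  case (LApp M N)
  then show ?case
    by simp (meson eta_rtranclp_cong rtranclp_trans)
qed auto

text \<open>Eta neither copies nor erases a redex, so at most one step closes each side. The only
  overlap is a root redex with a step in its head, which \<open>eta_ren_lamE\<close> brings down to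
  the unlifted head.\<close>

lemma eta_diamond:
  assumes "eta M N" "eta M P"
  shows "\<exists>Q. eta\<^sup>=\<^sup>= N Q \<and> eta\<^sup>=\<^sup>= P Q"
  using assms
proof (induction arbitrary: P rule: eta.induct)
  case (eta M)
  from eta show ?case
    by (auto elim!: eta_LLamE eta_LAppE eta_LVarE dest!: eta_ren_lamE intro: eta.eta)
next
  case (eta_lam M M')
  from eta_lam.prems show ?case
  proof cases
    case eta
    with eta_lam.hyps have "eta (LApp (ren_lam Suc P) (LVar 0)) M'"
      by simp
    then obtain P' where "eta P P'" "M' = LApp (ren_lam Suc P') (LVar 0)"
      by (auto elim!: eta_LAppE eta_LVarE dest!: eta_ren_lamE)
    then show ?thesis
      by (auto intro: eta.eta)
  next
    case (eta_lam M'')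
    then show ?thesis
      using eta_lam.IH[of M''] by (auto intro: eta.eta_lam)
  qed
next
  case (eta_app1 M M' N)
  from eta_app1.prems show ?case
  proof cases
    case (eta_app1 M'')
    then show ?thesis
      using eta_app1.IH[of M''] by (auto intro: eta.eta_app1)
  next
    case (eta_app2 N')
    then show ?thesis
      using eta_app1.hyps by (auto intro: eta.intros)
  qed
next
  case (eta_app2 N N' M)
  from eta_app2.prems show ?case
  proof cases
    case (eta_app1 M')
    then show ?thesis
      using eta_app2.hyps by (auto intro: eta.intros)
  next
    case (eta_app2 N'')
    then show ?thesis
      using eta_app2.IH[of N''] by (auto intro: eta.eta_app2)
  qed
qed

text \<open>The shape is asymmetric: beta may copy or erase the eta-redex, so many eta steps are
  allowed, while eta does not copy a beta-redex. The beta step can vanish, because in the overlaps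
  \<open>(\<lambda>x. M x) N\<close> and \<open>\<lambda>x. (\<lambda>y. B) x\<close> both reducts
  coincide.\<close>

lemma beta_eta_commute:
  fixes M :: "'c lam"
  assumes "beta_lam M N" "eta M P"
  shows "\<exists>Q. eta\<^sup>*\<^sup>* N Q \<and> beta_lam\<^sup>=\<^sup>= P Q"
  using assms
proof (induction arbitrary: P rule: beta_lam.induct)
  case (beta M N)
  from beta show ?case
  proof cases
    case (eta_app1 M')
    from eta_app1(2) show ?thesis
    proof cases
      case eta
      then show ?thesis
        using eta_app1(1) by auto
    next
      case (eta_lam M'')
      then show ?thesis
        using eta_app1(1) by (metis beta_lam.beta eta_sub_lam r_into_rtranclp sup2CI)
    qed
  next
    case (eta_app2 N')
    have "eta\<^sup>*\<^sup>* (inst_lam N n) (inst_lam N' n)" for n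
      using eta_app2 by (cases n) auto
    then show ?thesis
      using eta_app2(1) by (metis beta_lam.beta eta_sub_lam_arg sup2CI)
  qed
next
  case (lam M M')
  from lam.prems show ?case
  proof cases
    case eta
    with lam.hyps have "beta_lam (LApp (ren_lam Suc P) (LVar 0)) M'"
      by simp
    then show ?thesis
    proof cases
      case (beta A)
      then obtain B where B: "P = LLam B" "A = ren_lam (up_ren Suc) B"
        by (cases P) auto
      \<comment> \<open>Instantiating with index 0 undoes the lifted shift, so the beta reduct is
        \<open>LLam B\<close>, which is \<open>P\<close> itself.\<close>
      have "inst_lam (LVar 0) \<circ> up_ren Suc = (LVar :: nat \<Rightarrow> 'c lam)"
        by (rule nat_fun_eqI) simp_all
      then show ?thesis
        using B beta by (auto simp: sub_lam_ren_lam)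
    next
      case (app1 A)
      then show ?thesis
        by (metis beta_ren_lamE eta.eta r_into_rtranclp sup2CI)
    qed (auto elim: beta_LVarE)
  next
    case (eta_lam M'')
    then show ?thesis
      using lam.IH[of M''] by (auto intro: beta_lam.lam eta_rtranclp_cong)
  qed
next
  case (app1 M M' N)
  from app1.prems show ?case
  proof cases
    case (eta_app1 M'')
    then show ?thesis
      using app1.IH[of M''] by (auto intro: beta_lam.app1 eta_rtranclp_cong)
  next
    case (eta_app2 N')
    then show ?thesis
      using app1.hyps by (auto intro: eta.intros beta_lam.intros)
  qed
next
  case (app2 N N' M)
  from app2.prems show ?case
  proof cases
    case (eta_app1 M')
    then show ?thesis
      using app2.hyps by (auto intro: eta.intros beta_lam.intros)
  next
    case (eta_app2 N'')
    then show ?thesis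
      using app2.IH[of N''] by (auto intro: beta_lam.app2 eta_rtranclp_cong)
  qed
qed

lemma eta_strip:
  assumes "eta\<^sup>*\<^sup>* M N" "eta M P"
  shows "\<exists>Q. eta\<^sup>=\<^sup>= N Q \<and> eta\<^sup>*\<^sup>* P Q"
  using assms
proof (induction arbitrary: P rule: converse_rtranclp_induct)
  case base
  then show ?case
    by auto
next
  case (step M M')
  then obtain Q where "eta\<^sup>=\<^sup>= M' Q" "eta\<^sup>=\<^sup>= P Q"
    using eta_diamond by blast
  then show ?case
    using step.IH step.hyps(2) by (auto intro: converse_rtranclp_into_rtranclp)
qed

text \<open>A variable has no eta reduct, so when a step of the chain is traversed backwards,
  \<open>eta_strip\<close> can close the square only at the variable.\<close>

lemma eta_eq_LVar_iff: "eta_eq M (LVar n) \<longleftrightarrow> eta\<^sup>*\<^sup>* M (LVar n)"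
proof
  assume "eta_eq M (LVar n)"
  then have "equivclp eta M (LVar n)"
    by (simp add: eta_eq_def)
  then show "eta\<^sup>*\<^sup>* M (LVar n)"
  proof (induction rule: converse_equivclp_induct)
    case base
    then show ?case
      by simp
  next
    case (step M M')
    then show ?case
      using eta_strip[of M' "LVar n" M]
      by (auto elim: eta_LVarE intro: converse_rtranclp_into_rtranclp)
  qed
qed (simp add: eta_eq_def rtranclp_into_equivclp)

text \<open>The beta step is carried along the eta reduction to the variable. It must have vanished
  on arrival, since a variable is beta-normal.\<close>

lemma eta_eq_LVar_beta:
  assumes "eta_eq M (LVar n)" "beta_lam M N"
  shows "eta_eq N (LVar n)"
proof -
  have "eta\<^sup>*\<^sup>* M (LVar n)"
    using assms(1) by (simp add: eta_eq_LVar_iff)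
  \<comment> \<open>The reflexive closure is needed in the induction because commutation may turn
    the beta step into an identity.\<close>
  then have "eta\<^sup>*\<^sup>* N (LVar n)" if "beta_lam\<^sup>=\<^sup>= M N" for N
    using that
  proof (induction arbitrary: N rule: converse_rtranclp_induct)
    case base
    then show ?case
      by (auto elim: beta_LVarE)
  next
    case (step M M')
    show ?case
    proof (cases "M = N")
      case True
      then show ?thesis
        using step.hyps by auto
    next
      case False
      then obtain Q where "eta\<^sup>*\<^sup>* N Q" "beta_lam\<^sup>=\<^sup>= M' Q"
        using step beta_eta_commute[of M N M'] by auto
      then show ?thesis
        using step.IH by (meson rtranclp_trans)
    qed
  qed
  then show ?thesis
    using assms(2) by (simp add: eta_eq_LVar_iff)
qed

lemma eta_eq_refl [simp]: "eta_eq M M"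
  by (simp add: eta_eq_def)

lemma eta_eq_sym: "eta_eq M N \<Longrightarrow> eta_eq N M"
  by (simp add: eta_eq_def equivclp_sym)

lemma eta_eq_trans: "eta_eq M N \<Longrightarrow> eta_eq N P \<Longrightarrow> eta_eq M P"
  unfolding eta_eq_def by (rule equivclp_trans)

lemma equivclp_map:
  assumes "equivclp R x y" "\<And>x y. R x y \<Longrightarrow> equivclp S (f x) (f y)"
  shows "equivclp S (f x) (f y)"
  using assms(1)
proof (induction rule: equivclp_induct)
  case (step y z)
  then show ?case
    using assms(2) by (meson equivclp_sym equivclp_trans)
qed simp

lemma eta_eq_map:
  assumes "eta_eq M N" "\<And>M N. eta M N \<Longrightarrow> eta (f M) (f N)"
  shows "eta_eq (f M) (f N)"
  using assms unfolding eta_eq_def by (blast intro: equivclp_map)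

lemma eta_eq_sub_lam: "eta_eq M N \<Longrightarrow> eta_eq (sub_lam \<theta> M) (sub_lam \<theta> N)"
  by (erule eta_eq_map) (rule eta_sub_lam)

lemma eta_eq_cong:
  "eta_eq M M' \<Longrightarrow> eta_eq (LLam M) (LLam M')"
  "eta_eq M M' \<Longrightarrow> eta_eq (LApp M N) (LApp M' N)"
  "eta_eq N N' \<Longrightarrow> eta_eq (LApp M N) (LApp M N')"
  by (erule eta_eq_map, erule eta.intros)+

section \<open>Substitution, reduction and conversion of pseudo-terms\<close>

lemma ess_ren_obj: "ess (ren_obj \<xi> \<Delta>) = ren_lam \<xi> (ess \<Delta>)"
  by (induction \<Delta> arbitrary: \<xi> rule: ess.induct) simp_all

lemma ess_comp_up_sub: "ess \<circ> up_sub \<theta> = up_lam (ess \<circ> \<theta>)"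
  by (rule nat_fun_eqI) (simp_all add: ess_ren_obj)

lemma ess_sub_obj: "ess (sub_obj \<theta> \<Delta>) = sub_lam (ess \<circ> \<theta>) (ess \<Delta>)"
  by (induction \<Delta> arbitrary: \<theta> rule: ess.induct) (simp_all add: ess_comp_up_sub)

lemma ess_comp_inst: "ess \<circ> inst \<Delta> = inst_lam (ess \<Delta>)"
  by (rule nat_fun_eqI) simp_all

lemma ess_sub_inst: "ess (sub_obj (inst \<Delta>) \<Delta>') = sub_lam (inst_lam (ess \<Delta>)) (ess \<Delta>')"
  by (simp add: ess_sub_obj ess_comp_inst)

lemma wf_ren:
  fixes \<sigma> :: "('a, 'c) fam" and \<Delta> :: "('a, 'c) obj"
  shows "wf_fam strict \<sigma> \<Longrightarrow> wf_fam strict (ren_fam \<xi> \<sigma>)"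
    "wf_obj strict \<Delta> \<Longrightarrow> wf_obj strict (ren_obj \<xi> \<Delta>)"
  by (induction \<sigma> and \<Delta> arbitrary: \<xi> and \<xi>) (simp_all add: ess_ren_obj)

lemma wf_up_sub: "(\<And>n. wf_obj strict (\<theta> n)) \<Longrightarrow> wf_obj strict (up_sub \<theta> n)"
  by (cases n) (simp_all add: wf_ren)

lemma wf_inst: "wf_obj strict \<Delta> \<Longrightarrow> wf_obj strict (inst \<Delta> n)"
  by (cases n) simp_all

lemma wf_sub:
  fixes \<sigma> :: "('a, 'c) fam" and \<Delta> :: "('a, 'c) obj"
  shows "wf_fam strict \<sigma> \<Longrightarrow> (\<And>n. wf_obj strict (\<theta> n)) \<Longrightarrow> wf_fam strict (sub_fam \<theta> \<sigma>)"
    "wf_obj strict \<Delta> \<Longrightarrow> (\<And>n. wf_obj strict (\<theta> n)) \<Longrightarrow> wf_obj strict (sub_obj \<theta> \<Delta>)"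
  by (induction \<sigma> and \<Delta> arbitrary: \<theta> and \<theta>) (simp_all add: ess_sub_obj wf_up_sub)

lemma wf_sub_kind:
  "wf_kind strict K \<Longrightarrow> (\<And>n. wf_obj strict (\<theta> n)) \<Longrightarrow> wf_kind strict (sub_kind \<theta> K)"
  by (induction K arbitrary: \<theta>) (simp_all add: wf_up_sub wf_sub)

text \<open>The equality of essences in the pair and co-pair rules survives because
  \<open>ess\<close> commutes with substitution.\<close>

lemma red_sub:
  "red_fam \<sigma> \<sigma>' \<Longrightarrow> red_fam (sub_fam \<theta> \<sigma>) (sub_fam \<theta> \<sigma>')"
  "red_obj \<Delta> \<Delta>' \<Longrightarrow> red_obj (sub_obj \<theta> \<Delta>) (sub_obj \<theta> \<Delta>')"
  by (induction arbitrary: \<theta> and \<theta> rule: red_fam_red_obj.inducts)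
    (auto simp: sub_inst ess_sub_obj intro: red_fam_red_obj.intros)

lemma red_sub_kind: "red_kind K K' \<Longrightarrow> red_kind (sub_kind \<theta> K) (sub_kind \<theta> K')"
  by (induction arbitrary: \<theta> rule: red_kind.induct) (auto simp: red_sub intro: red_kind.intros)

text \<open>The typing rules compare families and kinds only. Equality of objects enters because a
  step in an argument also acts on the types into which the argument is substituted.\<close>

definition conv_obj :: "bool \<Rightarrow> ('a, 'c) obj \<Rightarrow> ('a, 'c) obj \<Rightarrow> bool" where
  "conv_obj strict = equivclp (\<lambda>\<Delta> \<Delta>'. wf_obj strict \<Delta> \<and> wf_obj strict \<Delta>' \<and> red_obj \<Delta> \<Delta>')"

lemmas conv_defs = conv_fam_def conv_kind_def conv_obj_def

lemma conv_refl [simp]: "conv_fam strict \<sigma> \<sigma>" "conv_kind strict K K" "conv_obj strict \<Delta> \<Delta>"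
  by (simp_all add: conv_defs)

lemma conv_sym:
  "conv_fam strict \<sigma> \<sigma>' \<Longrightarrow> conv_fam strict \<sigma>' \<sigma>"
  "conv_kind strict K K' \<Longrightarrow> conv_kind strict K' K"
  "conv_obj strict \<Delta> \<Delta>' \<Longrightarrow> conv_obj strict \<Delta>' \<Delta>"
  unfolding conv_defs by (rule equivclp_sym, assumption)+

lemma conv_trans [trans]:
  "conv_fam strict \<sigma> \<sigma>' \<Longrightarrow> conv_fam strict \<sigma>' \<sigma>'' \<Longrightarrow> conv_fam strict \<sigma> \<sigma>''"
  "conv_kind strict K K' \<Longrightarrow> conv_kind strict K' K'' \<Longrightarrow> conv_kind strict K K''"
  "conv_obj strict \<Delta> \<Delta>' \<Longrightarrow> conv_obj strict \<Delta>' \<Delta>'' \<Longrightarrow> conv_obj strict \<Delta> \<Delta>''"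
  unfolding conv_defs by (rule equivclp_trans, assumption+)+

lemma conv_red:
  "red_fam \<sigma> \<sigma>' \<Longrightarrow> wf_fam strict \<sigma> \<Longrightarrow> wf_fam strict \<sigma>' \<Longrightarrow> conv_fam strict \<sigma> \<sigma>'"
  "red_kind K K' \<Longrightarrow> wf_kind strict K \<Longrightarrow> wf_kind strict K' \<Longrightarrow> conv_kind strict K K'"
  "red_obj \<Delta> \<Delta>' \<Longrightarrow> wf_obj strict \<Delta> \<Longrightarrow> wf_obj strict \<Delta>' \<Longrightarrow> conv_obj strict \<Delta> \<Delta>'"
  unfolding conv_defs by blast+

lemma conv_fam_red_trans:
  assumes "conv_fam strict \<rho> \<sigma>" "red_fam \<sigma> \<sigma>' \<or> red_fam \<sigma>' \<sigma>" "wf_fam strict \<sigma>" "wf_fam strict \<sigma>'"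
  shows "conv_fam strict \<rho> \<sigma>'"
  using assms by (meson conv_red(1) conv_sym(1) conv_trans(1))

text \<open>To carry a conversion through a context \<open>f\<close>, it is enough to send each
  single admissible step to a conversion, possibly of several steps. The variants below differ in
  the syntactic sorts of argument and result.\<close>

lemma conv_fam_map:
  assumes "conv_fam strict \<sigma> \<sigma>'"
    "\<And>\<sigma> \<sigma>'. red_fam \<sigma> \<sigma>' \<Longrightarrow> wf_fam strict \<sigma> \<Longrightarrow> wf_fam strict \<sigma>' \<Longrightarrow> conv_fam strict (f \<sigma>) (f \<sigma>')"
  shows "conv_fam strict (f \<sigma>) (f \<sigma>')"
  using assms unfolding conv_defs by (blast intro: equivclp_map)

lemma conv_kind_map:
  assumes "conv_kind strict K K'"
    "\<And>K K'. red_kind K K' \<Longrightarrow> wf_kind strict K \<Longrightarrow> wf_kind strict K' \<Longrightarrow> conv_kind strict (f K) (f K')"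
  shows "conv_kind strict (f K) (f K')"
  using assms unfolding conv_defs by (blast intro: equivclp_map)

lemma conv_fam_map_obj:
  assumes "conv_obj strict \<Delta> \<Delta>'"
    "\<And>\<Delta> \<Delta>'. red_obj \<Delta> \<Delta>' \<Longrightarrow> wf_obj strict \<Delta> \<Longrightarrow> wf_obj strict \<Delta>' \<Longrightarrow> conv_fam strict (f \<Delta>) (f \<Delta>')"
  shows "conv_fam strict (f \<Delta>) (f \<Delta>')"
  using assms unfolding conv_defs by (blast intro: equivclp_map)

lemma conv_kind_map_obj:
  assumes "conv_obj strict \<Delta> \<Delta>'"
    "\<And>\<Delta> \<Delta>'. red_obj \<Delta> \<Delta>' \<Longrightarrow> wf_obj strict \<Delta> \<Longrightarrow> wf_obj strict \<Delta>' \<Longrightarrow> conv_kind strict (f \<Delta>) (f \<Delta>')"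
  shows "conv_kind strict (f \<Delta>) (f \<Delta>')"
  using assms unfolding conv_defs by (blast intro: equivclp_map)

lemma conv_kind_map_fam:
  assumes "conv_fam strict \<sigma> \<sigma>'"
    "\<And>\<sigma> \<sigma>'. red_fam \<sigma> \<sigma>' \<Longrightarrow> wf_fam strict \<sigma> \<Longrightarrow> wf_fam strict \<sigma>' \<Longrightarrow> conv_kind strict (f \<sigma>) (f \<sigma>')"
  shows "conv_kind strict (f \<sigma>) (f \<sigma>')"
  using assms unfolding conv_defs by (blast intro: equivclp_map)

lemma conv_obj_map_fam:
  assumes "conv_fam strict \<sigma> \<sigma>'"
    "\<And>\<sigma> \<sigma>'. red_fam \<sigma> \<sigma>' \<Longrightarrow> wf_fam strict \<sigma> \<Longrightarrow> wf_fam strict \<sigma>' \<Longrightarrow> conv_obj strict (f \<sigma>) (f \<sigma>')"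
  shows "conv_obj strict (f \<sigma>) (f \<sigma>')"
  using assms unfolding conv_defs by (blast intro: equivclp_map)

lemma conv_fam_sub:
  "conv_fam strict \<sigma> \<sigma>' \<Longrightarrow> (\<And>n. wf_obj strict (\<theta> n)) \<Longrightarrow>
    conv_fam strict (sub_fam \<theta> \<sigma>) (sub_fam \<theta> \<sigma>')"
  by (erule conv_fam_map) (blast intro: conv_red red_sub wf_sub)

lemma conv_kind_sub:
  "conv_kind strict K K' \<Longrightarrow> (\<And>n. wf_obj strict (\<theta> n)) \<Longrightarrow>
    conv_kind strict (sub_kind \<theta> K) (sub_kind \<theta> K')"
  by (erule conv_kind_map) (blast intro: conv_red red_sub_kind wf_sub_kind)

lemma conv_fam_ren: "conv_fam strict \<sigma> \<sigma>' \<Longrightarrow> conv_fam strict (ren_fam \<xi> \<sigma>) (ren_fam \<xi> \<sigma>')"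
  unfolding ren_eq_sub by (rule conv_fam_sub) simp_all

text \<open>The two components are converted one after the other. Admissibility is assumed of the
  component held fixed in each half: \<open>\<tau>\<close> while the domain moves, then
  \<open>\<sigma>'\<close> while the codomain moves. The next congruences follow the same
  scheme.\<close>

lemma conv_FPi:
  assumes "conv_fam strict \<sigma> \<sigma>'" "conv_fam strict \<tau> \<tau>'" "wf_fam strict \<sigma>'" "wf_fam strict \<tau>"
  shows "conv_fam strict (FPi \<sigma> \<tau>) (FPi \<sigma>' \<tau>')"
proof -
  have "conv_fam strict (FPi \<sigma> \<tau>) (FPi \<sigma>' \<tau>)"
    using assms(1) by (rule conv_fam_map) (auto intro!: conv_red red_fam_red_obj.intros assms)
  also have "conv_fam strict (FPi \<sigma>' \<tau>) (FPi \<sigma>' \<tau>')"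
    using assms(2) by (rule conv_fam_map) (auto intro!: conv_red(1) fpi2 assms)
  finally show ?thesis .
qed

lemma conv_FRel:
  assumes "conv_fam strict \<sigma> \<sigma>'" "conv_fam strict \<tau> \<tau>'" "wf_fam strict \<sigma>'" "wf_fam strict \<tau>"
  shows "conv_fam strict (FRel \<sigma> \<tau>) (FRel \<sigma>' \<tau>')"
proof -
  have "conv_fam strict (FRel \<sigma> \<tau>) (FRel \<sigma>' \<tau>)"
    using assms(1) by (rule conv_fam_map) (auto intro!: conv_red red_fam_red_obj.intros assms)
  also have "conv_fam strict (FRel \<sigma>' \<tau>) (FRel \<sigma>' \<tau>')"
    using assms(2) by (rule conv_fam_map) (auto intro!: conv_red(1) frel2 assms)
  finally show ?thesis .
qed

lemma conv_FInter:
  assumes "conv_fam strict \<sigma> \<sigma>'" "conv_fam strict \<tau> \<tau>'" "wf_fam strict \<sigma>'" "wf_fam strict \<tau>"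
  shows "conv_fam strict (FInter \<sigma> \<tau>) (FInter \<sigma>' \<tau>')"
proof -
  have "conv_fam strict (FInter \<sigma> \<tau>) (FInter \<sigma>' \<tau>)"
    using assms(1) by (rule conv_fam_map) (auto intro!: conv_red red_fam_red_obj.intros assms)
  also have "conv_fam strict (FInter \<sigma>' \<tau>) (FInter \<sigma>' \<tau>')"
    using assms(2) by (rule conv_fam_map) (auto intro!: conv_red(1) finter2 assms)
  finally show ?thesis .
qed

lemma conv_FUnion:
  assumes "conv_fam strict \<sigma> \<sigma>'" "conv_fam strict \<tau> \<tau>'" "wf_fam strict \<sigma>'" "wf_fam strict \<tau>"
  shows "conv_fam strict (FUnion \<sigma> \<tau>) (FUnion \<sigma>' \<tau>')"
proof -
  have "conv_fam strict (FUnion \<sigma> \<tau>) (FUnion \<sigma>' \<tau>)"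
    using assms(1) by (rule conv_fam_map) (auto intro!: conv_red red_fam_red_obj.intros assms)
  also have "conv_fam strict (FUnion \<sigma>' \<tau>) (FUnion \<sigma>' \<tau>')"
    using assms(2) by (rule conv_fam_map) (auto intro!: conv_red(1) funion2 assms)
  finally show ?thesis .
qed

lemma conv_FApp:
  assumes "conv_fam strict \<sigma> \<sigma>'" "conv_obj strict \<Delta> \<Delta>'" "wf_fam strict \<sigma>'" "wf_obj strict \<Delta>"
  shows "conv_fam strict (FApp \<sigma> \<Delta>) (FApp \<sigma>' \<Delta>')"
proof -
  have "conv_fam strict (FApp \<sigma> \<Delta>) (FApp \<sigma>' \<Delta>)"
    using assms(1) by (rule conv_fam_map) (auto intro!: conv_red red_fam_red_obj.intros assms)
  also have "conv_fam strict (FApp \<sigma>' \<Delta>) (FApp \<sigma>' \<Delta>')"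
    using assms(2) by (rule conv_fam_map_obj) (auto intro!: conv_red(1) fapp2 assms)
  finally show ?thesis .
qed

lemma conv_KPi:
  assumes "conv_fam strict \<sigma> \<sigma>'" "conv_kind strict K K'" "wf_fam strict \<sigma>'" "wf_kind strict K"
  shows "conv_kind strict (KPi \<sigma> K) (KPi \<sigma>' K')"
proof -
  have "conv_kind strict (KPi \<sigma> K) (KPi \<sigma>' K)"
    using assms(1) by (rule conv_kind_map_fam) (auto intro!: conv_red red_kind.intros assms)
  also have "conv_kind strict (KPi \<sigma>' K) (KPi \<sigma>' K')"
    using assms(2) by (rule conv_kind_map) (auto intro!: conv_red(2) kpi2 assms)
  finally show ?thesis .
qed

section \<open>Injectivity of the type formers under conversion\<close>

inductive_cases red_FPiE: "red_fam (FPi \<sigma> \<tau>) \<rho>"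
inductive_cases red_FRelE: "red_fam (FRel \<sigma> \<tau>) \<rho>"
inductive_cases red_FInterE: "red_fam (FInter \<sigma> \<tau>) \<rho>"
inductive_cases red_FUnionE: "red_fam (FUnion \<sigma> \<tau>) \<rho>"
inductive_cases red_to_FPiE: "red_fam \<rho> (FPi \<sigma> \<tau>)"
inductive_cases red_to_FRelE: "red_fam \<rho> (FRel \<sigma> \<tau>)"
inductive_cases red_to_FInterE: "red_fam \<rho> (FInter \<sigma> \<tau>)"
inductive_cases red_to_FUnionE: "red_fam \<rho> (FUnion \<sigma> \<tau>)"

text \<open>Conversion chains mix reductions with expansions, so an invariant must survive both.
  Below, \<open>P\<close> records the outer former together with the conversions of its components
  collected so far.\<close>

lemma conv_fam_invariant:
  assumes "conv_fam strict \<sigma> \<sigma>'" "P \<sigma>"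
    "\<And>\<sigma> \<sigma>'. P \<sigma> \<Longrightarrow> red_fam \<sigma> \<sigma>' \<Longrightarrow> wf_fam strict \<sigma> \<Longrightarrow> wf_fam strict \<sigma>' \<Longrightarrow> P \<sigma>'"
    "\<And>\<sigma> \<sigma>'. P \<sigma> \<Longrightarrow> red_fam \<sigma>' \<sigma> \<Longrightarrow> wf_fam strict \<sigma> \<Longrightarrow> wf_fam strict \<sigma>' \<Longrightarrow> P \<sigma>'"
  shows "P \<sigma>'"
  using assms(1,2) unfolding conv_fam_def
  by (induction rule: equivclp_induct) (use assms(3,4) in blast)+

lemma conv_FPiD:
  "conv_fam strict (FPi \<sigma> \<tau>) \<rho> \<Longrightarrow>
    \<exists>\<sigma>' \<tau>'. \<rho> = FPi \<sigma>' \<tau>' \<and> conv_fam strict \<sigma> \<sigma>' \<and> conv_fam strict \<tau> \<tau>'"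
  by (erule conv_fam_invariant)
    (auto elim!: red_FPiE red_to_FPiE intro: conv_fam_red_trans)

lemma conv_FRelD:
  "conv_fam strict (FRel \<sigma> \<tau>) \<rho> \<Longrightarrow>
    \<exists>\<sigma>' \<tau>'. \<rho> = FRel \<sigma>' \<tau>' \<and> conv_fam strict \<sigma> \<sigma>' \<and> conv_fam strict \<tau> \<tau>'"
  by (erule conv_fam_invariant)
    (auto elim!: red_FRelE red_to_FRelE intro: conv_fam_red_trans)

lemma conv_FInterD:
  "conv_fam strict (FInter \<sigma> \<tau>) \<rho> \<Longrightarrow>
    \<exists>\<sigma>' \<tau>'. \<rho> = FInter \<sigma>' \<tau>' \<and> conv_fam strict \<sigma> \<sigma>' \<and> conv_fam strict \<tau> \<tau>'"
  by (erule conv_fam_invariant)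
    (auto elim!: red_FInterE red_to_FInterE intro: conv_fam_red_trans)

lemma conv_FUnionD:
  "conv_fam strict (FUnion \<sigma> \<tau>) \<rho> \<Longrightarrow>
    \<exists>\<sigma>' \<tau>'. \<rho> = FUnion \<sigma>' \<tau>' \<and> conv_fam strict \<sigma> \<sigma>' \<and> conv_fam strict \<tau> \<tau>'"
  by (erule conv_fam_invariant)
    (auto elim!: red_FUnionE red_to_FUnionE intro: conv_fam_red_trans)

lemma conv_KTypeD: "conv_kind strict KType K \<Longrightarrow> K = KType"
  unfolding conv_kind_def
  by (induction rule: equivclp_induct) (auto elim: red_kind.cases)

text \<open>Naive congruence of conversion fails for objects, since the two components of a pair only
  reduce in lockstep.  Instead, both sides are beta-expanded to a redex with a common body.\<close>

lemma conv_obj_sub_arg: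
  assumes "red_obj (\<theta> k) (\<theta>' k)" "\<And>n. n \<noteq> k \<Longrightarrow> \<theta> n = \<theta>' n"
    "\<And>n. wf_obj strict (\<theta> n)" "\<And>n. wf_obj strict (\<theta>' n)" "wf_obj strict \<Delta>"
  shows "conv_obj strict (sub_obj \<theta> \<Delta>) (sub_obj \<theta>' \<Delta>)"
proof -
  \<comment> \<open>\<open>\<eta>\<close> reserves index 0 for the image of \<open>k\<close> and
    lifts every other image, so that instantiating with \<open>\<theta> k\<close> or
    \<open>\<theta>' k\<close> gives back \<open>\<theta>\<close> or
    \<open>\<theta>'\<close>.\<close>
  define \<eta> where "\<eta> n = (if n = k then Var 0 else ren_obj Suc (\<theta> n))" for n
  \<comment> \<open>Conversion lives on pseudo-terms, so the abstraction may be ill-typed and any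
    admissible family can serve as its annotation.\<close>
  define L where "L = Lam (FConst undefined) (sub_obj \<eta> \<Delta>)"
  have \<eta>: "sub_obj (inst (\<theta> k)) \<circ> \<eta> = \<theta>" "sub_obj (inst (\<theta>' k)) \<circ> \<eta> = \<theta>'"
    using assms(2) by (auto simp: \<eta>_def fun_eq_iff)
  have L: "red_obj (App L (\<theta> k)) (sub_obj \<theta> \<Delta>)" "red_obj (App L (\<theta>' k)) (sub_obj \<theta>' \<Delta>)"
    using red_fam_red_obj.beta[of "FConst undefined" "sub_obj \<eta> \<Delta>"] by (metis L_def \<eta> sub_sub(2))+
  have wf: "wf_obj strict L"
    using assms by (auto simp: L_def \<eta>_def intro!: wf_sub wf_ren)
  have "conv_obj strict (sub_obj \<theta> \<Delta>) (App L (\<theta> k))"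
    using L(1) wf assms by (auto intro!: conv_sym(3)[OF conv_red(3)] wf_sub)
  also have "conv_obj strict (App L (\<theta> k)) (App L (\<theta>' k))"
    using wf assms by (auto intro!: conv_red(3) red_fam_red_obj.app2)
  also have "conv_obj strict (App L (\<theta>' k)) (sub_obj \<theta>' \<Delta>)"
    using L(2) wf assms by (auto intro!: conv_red(3) wf_sub)
  finally show ?thesis .
qed

lemma up_sub_arg:
  assumes "red_obj (\<theta> k) (\<theta>' k)" "\<And>n. n \<noteq> k \<Longrightarrow> \<theta> n = \<theta>' n"
  shows "red_obj (up_sub \<theta> (Suc k)) (up_sub \<theta>' (Suc k))"
    "n \<noteq> Suc k \<Longrightarrow> up_sub \<theta> n = up_sub \<theta>' n"
  using assms by (cases n; auto simp: ren_eq_sub red_sub)+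

text \<open>Two substitutions differing at an arbitrary index \<open>k\<close> are compared, because
  passing a binder moves the difference to \<open>Suc k\<close>; a statement about
  \<open>inst\<close> alone would not be inductive.\<close>

lemma conv_fam_sub_arg:
  assumes "red_obj (\<theta> k) (\<theta>' k)" "\<And>n. n \<noteq> k \<Longrightarrow> \<theta> n = \<theta>' n"
    "\<And>n. wf_obj strict (\<theta> n)" "\<And>n. wf_obj strict (\<theta>' n)" "wf_fam strict \<sigma>"
  shows "conv_fam strict (sub_fam \<theta> \<sigma>) (sub_fam \<theta>' \<sigma>)"
proof -
  \<comment> \<open>The induction is mutual with objects, for which the trivial claim suffices: they
    occur in families as arguments of \<open>FApp\<close>, where \<open>conv_obj_sub_arg\<close>
    applies.\<close>
  have "red_obj (\<theta> k) (\<theta>' k) \<Longrightarrow> (\<forall>n. n \<noteq> k \<longrightarrow> \<theta> n = \<theta>' n) \<Longrightarrow>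
      (\<forall>n. wf_obj strict (\<theta> n)) \<Longrightarrow> (\<forall>n. wf_obj strict (\<theta>' n)) \<Longrightarrow> wf_fam strict \<sigma> \<Longrightarrow>
      conv_fam strict (sub_fam \<theta> \<sigma>) (sub_fam \<theta>' \<sigma>)"
    and "True" for \<theta> \<theta>' k and \<Delta> :: "('a, 'b) obj"
  proof (induction \<sigma> and \<Delta> arbitrary: \<theta> \<theta>' k)
    case (FPi \<sigma> \<tau>)
    have "conv_fam strict (sub_fam (up_sub \<theta>) \<tau>) (sub_fam (up_sub \<theta>') \<tau>)"
      using FPi.prems up_sub_arg[of \<theta> k \<theta>'] by (intro FPi.IH(2)[of _ "Suc k"]) (auto simp: wf_up_sub)
    then show ?case
      using FPi by (auto intro!: conv_FPi wf_sub wf_up_sub)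
  next
    case (FApp \<sigma> \<Delta>)
    then show ?case
      by (auto intro!: conv_FApp wf_sub conv_obj_sub_arg[of \<theta> k])
  qed (auto intro!: conv_FRel conv_FInter conv_FUnion wf_sub)
  with assms show ?thesis
    by blast
qed

lemma conv_kind_sub_arg:
  assumes "red_obj (\<theta> k) (\<theta>' k)" "\<And>n. n \<noteq> k \<Longrightarrow> \<theta> n = \<theta>' n"
    "\<And>n. wf_obj strict (\<theta> n)" "\<And>n. wf_obj strict (\<theta>' n)" "wf_kind strict K"
  shows "conv_kind strict (sub_kind \<theta> K) (sub_kind \<theta>' K)"
  using assms
proof (induction K arbitrary: \<theta> \<theta>' k)
  case (KPi \<sigma> K)
  have "conv_kind strict (sub_kind (up_sub \<theta>) K) (sub_kind (up_sub \<theta>') K)"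
    using KPi.prems up_sub_arg[of \<theta> k \<theta>'] by (intro KPi.IH[of _ "Suc k"]) (auto simp: wf_up_sub)
  moreover have "conv_fam strict (sub_fam \<theta> \<sigma>) (sub_fam \<theta>' \<sigma>)"
    using KPi.prems by (intro conv_fam_sub_arg[of _ k]) auto
  ultimately show ?case
    using KPi.prems by (auto intro!: conv_KPi wf_sub wf_sub_kind wf_up_sub)
qed simp

lemma conv_fam_sub_inst:
  assumes "conv_obj strict \<Delta> \<Delta>'" "wf_fam strict \<sigma>"
  shows "conv_fam strict (sub_fam (inst \<Delta>) \<sigma>) (sub_fam (inst \<Delta>') \<sigma>)"
  using assms(1)
proof (rule conv_fam_map_obj)
  fix \<Delta> \<Delta>' :: "('a, 'b) obj"
  assume *: "red_obj \<Delta> \<Delta>'" "wf_obj strict \<Delta>" "wf_obj strict \<Delta>'"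
  have "inst \<Delta> n = inst \<Delta>' n" if "n \<noteq> 0" for n
    using that by (cases n) auto
  then show "conv_fam strict (sub_fam (inst \<Delta>) \<sigma>) (sub_fam (inst \<Delta>') \<sigma>)"
    using * assms(2) by (intro conv_fam_sub_arg[of _ 0]) (auto simp: wf_inst)
qed

lemma conv_kind_sub_inst:
  assumes "conv_obj strict \<Delta> \<Delta>'" "wf_kind strict K"
  shows "conv_kind strict (sub_kind (inst \<Delta>) K) (sub_kind (inst \<Delta>') K)"
  using assms(1)
proof (rule conv_kind_map_obj)
  fix \<Delta> \<Delta>' :: "('a, 'b) obj"
  assume *: "red_obj \<Delta> \<Delta>'" "wf_obj strict \<Delta>" "wf_obj strict \<Delta>'"
  have "inst \<Delta> n = inst \<Delta>' n" if "n \<noteq> 0" for n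
    using that by (cases n) auto
  then show "conv_kind strict (sub_kind (inst \<Delta>) K) (sub_kind (inst \<Delta>') K)"
    using * assms(2) by (intro conv_kind_sub_arg[of _ 0]) (auto simp: wf_inst)
qed

section \<open>Structural properties of typing\<close>

lemmas typing_induct = sig_ok_ctx_ok_kind_ok_fam_has_obj_has.inducts
lemmas typing_intros = sig_empty sig_fam sig_obj ctx_empty ctx_var kind_type kind_pi
  fam_const fam_pi fam_app fam_rel fam_inter fam_union
  obj_const obj_var obj_lam obj_app obj_rlam obj_rapp obj_pair obj_prl obj_prr obj_inl obj_inr obj_copair

inductive_cases ctx_ok_ConsE: "ctx_ok strict \<Sigma> (\<sigma> # \<Gamma>)"
inductive_cases kind_ok_KPiE: "kind_ok strict \<Sigma> \<Gamma> (KPi \<sigma> K)"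

text \<open>Admissibility of the context is part of the claim because \<open>kind_pi\<close>,
  \<open>fam_pi\<close> and \<open>obj_lam\<close> mention the domain only as head of the context of
  their premise. Admissibility of types has to wait for regularity.\<close>

lemma typing_wf:
  shows "sig_ok strict \<Sigma> \<Longrightarrow> True"
    and "ctx_ok strict \<Sigma> \<Gamma> \<Longrightarrow> list_all (wf_fam strict) \<Gamma>"
    and "kind_ok strict \<Sigma> \<Gamma> K \<Longrightarrow> list_all (wf_fam strict) \<Gamma> \<and> wf_kind strict K"
    and "fam_has strict \<Sigma> \<Gamma> \<sigma> K \<Longrightarrow> list_all (wf_fam strict) \<Gamma> \<and> wf_fam strict \<sigma>"
    and "obj_has strict \<Sigma> \<Gamma> \<Delta> \<sigma> \<Longrightarrow> list_all (wf_fam strict) \<Gamma> \<and> wf_obj strict \<Delta>"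
  by (induction rule: typing_induct) auto

lemmas kind_ok_wf = typing_wf(3)[THEN conjunct2]
lemmas fam_has_wf = typing_wf(4)[THEN conjunct2]
lemmas obj_has_wf = typing_wf(5)[THEN conjunct2]

lemma typing_ctx_ok:
  shows "sig_ok strict \<Sigma> \<Longrightarrow> True"
    and "ctx_ok strict \<Sigma> \<Gamma> \<Longrightarrow> True"
    and "kind_ok strict \<Sigma> \<Gamma> K \<Longrightarrow> ctx_ok strict \<Sigma> \<Gamma>"
    and "fam_has strict \<Sigma> \<Gamma> \<sigma> K \<Longrightarrow> ctx_ok strict \<Sigma> \<Gamma>"
    and "obj_has strict \<Sigma> \<Gamma> \<Delta> \<sigma> \<Longrightarrow> ctx_ok strict \<Sigma> \<Gamma>"
  by (induction rule: typing_induct) (auto elim: ctx_ok_ConsE)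

lemma ctx_ok_sig_ok: "ctx_ok strict \<Sigma> \<Gamma> \<Longrightarrow> sig_ok strict \<Sigma>"
proof (induction \<Gamma>)
  case Nil
  then show ?case
    by cases
next
  case (Cons \<sigma> \<Gamma>)
  then show ?case
    by (blast elim: ctx_ok_ConsE)
qed

section \<open>Scoping and closedness of declarations\<close>

primrec ctx_all :: "(('a, 'c) fam \<Rightarrow> ('a, 'c) ctx \<Rightarrow> bool) \<Rightarrow> ('a, 'c) ctx \<Rightarrow> bool" where
  "ctx_all P [] \<longleftrightarrow> True"
| "ctx_all P (\<sigma> # \<Gamma>) \<longleftrightarrow> P \<sigma> \<Gamma> \<and> ctx_all P \<Gamma>"

text \<open>Having all free indices below \<open>n\<close> is expressed as invariance under every
  substitution fixing those indices, which is the form in which closedness is used.\<close>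

definition scoped_fam :: "nat \<Rightarrow> ('a, 'c) fam \<Rightarrow> bool" where
  "scoped_fam n \<sigma> \<longleftrightarrow> (\<forall>\<theta>. (\<forall>i<n. \<theta> i = Var i) \<longrightarrow> sub_fam \<theta> \<sigma> = \<sigma>)"

definition scoped_obj :: "nat \<Rightarrow> ('a, 'c) obj \<Rightarrow> bool" where
  "scoped_obj n \<Delta> \<longleftrightarrow> (\<forall>\<theta>. (\<forall>i<n. \<theta> i = Var i) \<longrightarrow> sub_obj \<theta> \<Delta> = \<Delta>)"

definition scoped_kind :: "nat \<Rightarrow> ('a, 'c) kind \<Rightarrow> bool" where
  "scoped_kind n K \<longleftrightarrow> (\<forall>\<theta>. (\<forall>i<n. \<theta> i = Var i) \<longrightarrow> sub_kind \<theta> K = K)"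

lemmas scoped_defs = scoped_fam_def scoped_obj_def scoped_kind_def

lemma up_sub_scope: "\<forall>i<n. \<theta> i = Var i \<Longrightarrow> \<forall>i<Suc n. up_sub \<theta> i = Var i"
  by (auto simp: less_Suc_eq_0_disj)

lemma scoped_up:
  assumes "\<forall>i<n. \<theta> i = Var i"
  shows "scoped_fam (Suc n) \<sigma> \<Longrightarrow> sub_fam (up_sub \<theta>) \<sigma> = \<sigma>"
    "scoped_kind (Suc n) K \<Longrightarrow> sub_kind (up_sub \<theta>) K = K"
    "scoped_obj (Suc n) \<Delta> \<Longrightarrow> sub_obj (up_sub \<theta>) \<Delta> = \<Delta>"
  using up_sub_scope[OF assms] unfolding scoped_defs by blast+

lemma scoped_binders:
  assumes "scoped_fam n \<sigma>"
  shows "scoped_fam (Suc n) \<tau> \<Longrightarrow> scoped_fam n (FPi \<sigma> \<tau>)"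
    "scoped_kind (Suc n) K \<Longrightarrow> scoped_kind n (KPi \<sigma> K)"
    "scoped_obj (Suc n) \<Delta> \<Longrightarrow> scoped_obj n (Lam \<sigma> \<Delta>)"
    "scoped_obj (Suc n) \<Delta> \<Longrightarrow> scoped_obj n (RLam \<sigma> \<Delta>)"
proof -
  have \<sigma>: "sub_fam \<theta> \<sigma> = \<sigma>" if "\<forall>i<n. \<theta> i = Var i" for \<theta>
    using assms that unfolding scoped_fam_def by blast
  show "scoped_fam (Suc n) \<tau> \<Longrightarrow> scoped_fam n (FPi \<sigma> \<tau>)"
    unfolding scoped_fam_def[of n] by (intro allI impI) (simp only: sub_fam.simps \<sigma> scoped_up)
  show "scoped_kind (Suc n) K \<Longrightarrow> scoped_kind n (KPi \<sigma> K)"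
    unfolding scoped_kind_def[of n] by (intro allI impI) (simp only: sub_kind.simps \<sigma> scoped_up)
  show "scoped_obj (Suc n) \<Delta> \<Longrightarrow> scoped_obj n (Lam \<sigma> \<Delta>)"
    unfolding scoped_obj_def[of n] by (intro allI impI) (simp only: sub_obj.simps \<sigma> scoped_up)
  show "scoped_obj (Suc n) \<Delta> \<Longrightarrow> scoped_obj n (RLam \<sigma> \<Delta>)"
    unfolding scoped_obj_def[of n] by (intro allI impI) (simp only: sub_obj.simps \<sigma> scoped_up)
qed

lemma scoped_simps:
  "scoped_kind n KType" "scoped_fam n (FConst a)" "scoped_obj n (Const c)"
  "i < n \<Longrightarrow> scoped_obj n (Var i)"
  "scoped_fam n (FApp \<sigma> \<Delta>) \<longleftrightarrow> scoped_fam n \<sigma> \<and> scoped_obj n \<Delta>"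
  "scoped_fam n (FRel \<sigma> \<tau>) \<longleftrightarrow> scoped_fam n \<sigma> \<and> scoped_fam n \<tau>"
  "scoped_fam n (FInter \<sigma> \<tau>) \<longleftrightarrow> scoped_fam n \<sigma> \<and> scoped_fam n \<tau>"
  "scoped_fam n (FUnion \<sigma> \<tau>) \<longleftrightarrow> scoped_fam n \<sigma> \<and> scoped_fam n \<tau>"
  "scoped_obj n (App \<Delta>1 \<Delta>2) \<longleftrightarrow> scoped_obj n \<Delta>1 \<and> scoped_obj n \<Delta>2"
  "scoped_obj n (RApp \<Delta>1 \<Delta>2) \<longleftrightarrow> scoped_obj n \<Delta>1 \<and> scoped_obj n \<Delta>2"
  "scoped_obj n (Pair \<Delta>1 \<Delta>2) \<longleftrightarrow> scoped_obj n \<Delta>1 \<and> scoped_obj n \<Delta>2"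
  "scoped_obj n (Copair \<Delta>1 \<Delta>2) \<longleftrightarrow> scoped_obj n \<Delta>1 \<and> scoped_obj n \<Delta>2"
  "scoped_obj n (PrL \<Delta>) \<longleftrightarrow> scoped_obj n \<Delta>"
  "scoped_obj n (PrR \<Delta>) \<longleftrightarrow> scoped_obj n \<Delta>"
  "scoped_obj n (InL \<tau> \<Delta>) \<longleftrightarrow> scoped_fam n \<tau> \<and> scoped_obj n \<Delta>"
  "scoped_obj n (InR \<tau> \<Delta>) \<longleftrightarrow> scoped_fam n \<tau> \<and> scoped_obj n \<Delta>"
  by (auto simp: scoped_defs)

abbreviation scoped_ctx :: "('a, 'c) ctx \<Rightarrow> bool" where
  "scoped_ctx \<equiv> ctx_all (\<lambda>\<sigma> \<Gamma>. scoped_fam (length \<Gamma>) \<sigma>)"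

lemma typing_scoped:
  shows "sig_ok strict \<Sigma> \<Longrightarrow> True"
    and "ctx_ok strict \<Sigma> \<Gamma> \<Longrightarrow> scoped_ctx \<Gamma>"
    and "kind_ok strict \<Sigma> \<Gamma> K \<Longrightarrow> scoped_ctx \<Gamma> \<and> scoped_kind (length \<Gamma>) K"
    and "fam_has strict \<Sigma> \<Gamma> \<sigma> K \<Longrightarrow> scoped_ctx \<Gamma> \<and> scoped_fam (length \<Gamma>) \<sigma>"
    and "obj_has strict \<Sigma> \<Gamma> \<Delta> \<sigma> \<Longrightarrow> scoped_ctx \<Gamma> \<and> scoped_obj (length \<Gamma>) \<Delta>"
  by (induction rule: typing_induct) (auto simp: scoped_simps intro: scoped_binders)

text \<open>Declarations are typed in the empty context, where the condition on
  \<open>\<theta>\<close> in scopedness is vacuous. Constants can thus keep their unlifted declared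
  kind or type under substitution.\<close>

lemma sig_decl_closed:
  assumes "sig_ok strict \<Sigma>"
  shows "FamDecl a K \<in> set \<Sigma> \<Longrightarrow> sub_kind \<theta> K = K"
    and "ObjDecl c \<sigma> \<in> set \<Sigma> \<Longrightarrow> sub_fam \<theta> \<sigma> = \<sigma>"
proof -
  have "(FamDecl a K \<in> set \<Sigma> \<longrightarrow> sub_kind \<theta> K = K) \<and> (ObjDecl c \<sigma> \<in> set \<Sigma> \<longrightarrow> sub_fam \<theta> \<sigma> = \<sigma>)"
    using assms
  proof (induction \<Sigma> rule: list.induct)
    case (Cons d \<Sigma>)
    from Cons.prems show ?case
      by cases (use Cons.IH in \<open>auto dest!: typing_scoped(3,4) simp: scoped_defs\<close>)
  qed simp
  then show "FamDecl a K \<in> set \<Sigma> \<Longrightarrow> sub_kind \<theta> K = K"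
    and "ObjDecl c \<sigma> \<in> set \<Sigma> \<Longrightarrow> sub_fam \<theta> \<sigma> = \<sigma>"
    by auto
qed

text \<open>The predicate T abstracts over what makes a substitution well-typed: it is instantiated first
  with renamings, which yields weakening, and then with arbitrary typed substitutions.\<close>

lemma typing_sub_general:
  fixes T :: "('a, 'c) sig \<Rightarrow> (nat \<Rightarrow> ('a, 'c) obj) \<Rightarrow> ('a, 'c) ctx \<Rightarrow> ('a, 'c) ctx \<Rightarrow> bool"
  assumes ctx: "\<And>\<Sigma> \<theta> \<Gamma> \<Gamma>'. T \<Sigma> \<theta> \<Gamma> \<Gamma>' \<Longrightarrow> ctx_ok strict \<Sigma> \<Gamma>'"
    and var: "\<And>\<Sigma> \<theta> \<Gamma> \<Gamma>' i. T \<Sigma> \<theta> \<Gamma> \<Gamma>' \<Longrightarrow> i < length \<Gamma> \<Longrightarrow>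
      obj_has strict \<Sigma> \<Gamma>' (\<theta> i) (sub_fam \<theta> (ren_fam (\<lambda>n. n + Suc i) (\<Gamma> ! i)))"
    and wf: "\<And>\<Sigma> \<theta> \<Gamma> \<Gamma>' n. T \<Sigma> \<theta> \<Gamma> \<Gamma>' \<Longrightarrow> wf_obj strict (\<theta> n)"
    and up: "\<And>\<Sigma> \<theta> \<Gamma> \<Gamma>' \<sigma>. T \<Sigma> \<theta> \<Gamma> \<Gamma>' \<Longrightarrow> fam_has strict \<Sigma> \<Gamma>' (sub_fam \<theta> \<sigma>) KType \<Longrightarrow>
      T \<Sigma> (up_sub \<theta>) (\<sigma> # \<Gamma>) (sub_fam \<theta> \<sigma> # \<Gamma>')"
  defines "C \<equiv> \<lambda>\<Sigma>. ctx_all (\<lambda>\<sigma> \<Gamma>. \<forall>\<theta> \<Gamma>'. T \<Sigma> \<theta> \<Gamma> \<Gamma>' \<longrightarrow> fam_has strict \<Sigma> \<Gamma>' (sub_fam \<theta> \<sigma>) KType)"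
  shows "sig_ok strict \<Sigma> \<Longrightarrow> True"
    and "ctx_ok strict \<Sigma> \<Gamma> \<Longrightarrow> C \<Sigma> \<Gamma>"
    and "kind_ok strict \<Sigma> \<Gamma> K \<Longrightarrow> C \<Sigma> \<Gamma> \<and>
      (\<forall>\<theta> \<Gamma>'. T \<Sigma> \<theta> \<Gamma> \<Gamma>' \<longrightarrow> kind_ok strict \<Sigma> \<Gamma>' (sub_kind \<theta> K))"
    and "fam_has strict \<Sigma> \<Gamma> \<sigma> K \<Longrightarrow> C \<Sigma> \<Gamma> \<and>
      (\<forall>\<theta> \<Gamma>'. T \<Sigma> \<theta> \<Gamma> \<Gamma>' \<longrightarrow> fam_has strict \<Sigma> \<Gamma>' (sub_fam \<theta> \<sigma>) (sub_kind \<theta> K))"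
    and "obj_has strict \<Sigma> \<Gamma> \<Delta> \<sigma> \<Longrightarrow> C \<Sigma> \<Gamma> \<and>
      (\<forall>\<theta> \<Gamma>'. T \<Sigma> \<theta> \<Gamma> \<Gamma>' \<longrightarrow> obj_has strict \<Sigma> \<Gamma>' (sub_obj \<theta> \<Delta>) (sub_fam \<theta> \<sigma>))"
proof (induction rule: typing_induct)
  case (fam_const \<Sigma> \<Gamma> a K)
  then show ?case
    by (auto intro!: sig_ok_ctx_ok_kind_ok_fam_has_obj_has.fam_const
        simp: sig_decl_closed(1)[OF ctx_ok_sig_ok] dest: ctx)
next
  case (obj_const \<Sigma> \<Gamma> c \<sigma>)
  then show ?case
    by (auto intro!: sig_ok_ctx_ok_kind_ok_fam_has_obj_has.obj_const
        simp: sig_decl_closed(2)[OF ctx_ok_sig_ok] dest: ctx)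
next
  case (fam_app \<Sigma> \<Gamma> \<sigma> \<tau> K \<Delta>)
  then show ?case
    by (simp add: sub_inst) (blast intro: sig_ok_ctx_ok_kind_ok_fam_has_obj_has.fam_app)
next
  case (fam_conv \<Sigma> \<Gamma> \<sigma> K1 K2)
  then show ?case
    by (meson conv_kind_sub sig_ok_ctx_ok_kind_ok_fam_has_obj_has.fam_conv wf)
next
  case (obj_app \<Sigma> \<Gamma> \<Delta>1 \<sigma> \<tau> \<Delta>2)
  then show ?case
    by (simp add: sub_inst) (blast intro: sig_ok_ctx_ok_kind_ok_fam_has_obj_has.obj_app)
next
  case rlam: (obj_rlam \<Sigma> \<sigma> \<Gamma> \<Delta> \<tau>)
  have "obj_has strict \<Sigma> \<Gamma>' (sub_obj \<theta> (RLam \<sigma> \<Delta>)) (sub_fam \<theta> (FRel \<sigma> \<tau>))"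
    if T: "T \<Sigma> \<theta> \<Gamma> \<Gamma>'" for \<theta> \<Gamma>'
  proof -
    \<comment> \<open>Going under the binder requires the substituted domain to be well-kinded. This
      comes from the component \<open>C\<close> of the induction hypothesis, which covers the
      entries of the context of the premise.\<close>
    have "T \<Sigma> (up_sub \<theta>) (\<sigma> # \<Gamma>) (sub_fam \<theta> \<sigma> # \<Gamma>')"
      using rlam.IH T by (auto simp: C_def intro: up)
    then have "obj_has strict \<Sigma> (sub_fam \<theta> \<sigma> # \<Gamma>') (sub_obj (up_sub \<theta>) \<Delta>) (ren_fam Suc (sub_fam \<theta> \<tau>))"
      using rlam.IH sub_up_ren_Suc(1)[of \<theta> \<tau>] by metis
    \<comment> \<open>A lifted substitution fixes \<open>LVar 0\<close>, so eta-equality to the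
      bound variable is preserved.\<close>
    moreover have "eta_eq (ess (sub_obj (up_sub \<theta>) \<Delta>)) (LVar 0)"
      using rlam eta_eq_sub_lam[of "ess \<Delta>" "LVar 0" "up_lam (ess \<circ> \<theta>)"]
      by (simp add: ess_sub_obj ess_comp_up_sub)
    moreover have "fam_has strict \<Sigma> \<Gamma>' (sub_fam \<theta> (FRel \<sigma> \<tau>)) KType"
      using rlam.IH T by auto
    ultimately show ?thesis
      by (simp add: obj_rlam)
  qed
  then show ?case
    using rlam.IH by auto
next
  case copair: (obj_copair \<Sigma> \<Gamma> \<Delta>1 \<sigma> \<tau> \<rho> \<Delta>2)
  have "obj_has strict \<Sigma> \<Gamma>' (sub_obj \<theta> (Copair \<Delta>1 \<Delta>2)) (sub_fam \<theta> (FPi (FUnion \<sigma> \<tau>) \<rho>))"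
    if T: "T \<Sigma> \<theta> \<Gamma> \<Gamma>'" for \<theta> \<Gamma>'
  proof -
    have "C \<Sigma> (FUnion \<sigma> \<tau> # \<Gamma>)"
      using copair by blast
    then have "T \<Sigma> (up_sub \<theta>) (FUnion \<sigma> \<tau> # \<Gamma>) (sub_fam \<theta> (FUnion \<sigma> \<tau>) # \<Gamma>')"
      using T by (intro up) (simp_all add: C_def)
    then have "fam_has strict \<Sigma> (sub_fam \<theta> (FUnion \<sigma> \<tau>) # \<Gamma>') (sub_fam (up_sub \<theta>) \<rho>) (sub_kind (up_sub \<theta>) KType)"
      using copair by blast
    moreover have "obj_has strict \<Sigma> \<Gamma>' (sub_obj \<theta> \<Delta>1)
        (sub_fam \<theta> (FPi \<sigma> (sub_fam (repl (InL (ren_fam Suc \<tau>) (Var 0))) \<rho>)))"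
      using copair T by blast
    moreover have "obj_has strict \<Sigma> \<Gamma>' (sub_obj \<theta> \<Delta>2)
        (sub_fam \<theta> (FPi \<tau> (sub_fam (repl (InR (ren_fam Suc \<sigma>) (Var 0))) \<rho>)))"
      using copair T by blast
    moreover have "eta_eq (ess (sub_obj \<theta> \<Delta>1)) (ess (sub_obj \<theta> \<Delta>2))"
      using copair by (simp add: ess_sub_obj eta_eq_sub_lam)
    moreover have "strict \<longrightarrow> ess (sub_obj \<theta> \<Delta>1) = ess (sub_obj \<theta> \<Delta>2)"
      using copair by (simp add: ess_sub_obj)
    ultimately show ?thesis
      by (simp add: obj_copair sub_repl[OF refl] sub_up_ren_Suc)
  qed
  then show ?case
    using copair.IH by auto
next
  case (obj_pair \<Sigma> \<Gamma> \<Delta>1 \<sigma> \<Delta>2 \<tau>)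
  then show ?case
    by (auto simp: ess_sub_obj intro!: sig_ok_ctx_ok_kind_ok_fam_has_obj_has.obj_pair eta_eq_sub_lam)
next
  case (obj_conv \<Sigma> \<Gamma> \<Delta> \<sigma> \<tau>)
  then show ?case
    by simp (meson conv_fam_sub sig_ok_ctx_ok_kind_ok_fam_has_obj_has.obj_conv wf)
next
  case (obj_prl \<Sigma> \<Gamma> \<Delta> \<sigma> \<tau>)
  then show ?case
    by simp (blast intro: sig_ok_ctx_ok_kind_ok_fam_has_obj_has.obj_prl)
next
  case (obj_prr \<Sigma> \<Gamma> \<Delta> \<sigma> \<tau>)
  then show ?case
    by simp (blast intro: sig_ok_ctx_ok_kind_ok_fam_has_obj_has.obj_prr)
next
  case (obj_rapp \<Sigma> \<Gamma> \<Delta>1 \<sigma> \<tau> \<Delta>2)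
  then show ?case
    by simp (blast intro: sig_ok_ctx_ok_kind_ok_fam_has_obj_has.obj_rapp)
next
  case (obj_var \<Sigma> \<Gamma> i)
  then show ?case
    using var by simp
next
  case sig_empty
  then show ?case
    by simp
next
  case sig_fam
  then show ?case
    by simp
next
  case sig_obj
  then show ?case
    by simp
next
  case (ctx_empty \<Sigma>)
  then show ?case
    by (simp add: C_def)
next
  case (ctx_var \<Sigma> \<Gamma> \<sigma>)
  then show ?case
    by (simp add: C_def)
next
  case (kind_type \<Sigma> \<Gamma>)
  then show ?case
    by (simp add: ctx sig_ok_ctx_ok_kind_ok_fam_has_obj_has.kind_type)
next
  case (kind_pi \<Sigma> \<sigma> \<Gamma> K)
  then show ?case
    by (simp add: C_def) (blast intro: up sig_ok_ctx_ok_kind_ok_fam_has_obj_has.kind_pi)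
next
  case (fam_pi \<Sigma> \<sigma> \<Gamma> \<tau>)
  then show ?case
    by (simp add: C_def) (blast intro: up sig_ok_ctx_ok_kind_ok_fam_has_obj_has.fam_pi)
next
  case (obj_lam \<Sigma> \<sigma> \<Gamma> \<Delta> \<tau>)
  then show ?case
    by (simp add: C_def) (blast intro: up sig_ok_ctx_ok_kind_ok_fam_has_obj_has.obj_lam)
next
  case (fam_rel \<Sigma> \<Gamma> \<sigma> \<tau>)
  then show ?case
    by (simp add: sig_ok_ctx_ok_kind_ok_fam_has_obj_has.fam_rel)
next
  case (fam_inter \<Sigma> \<Gamma> \<sigma> \<tau>)
  then show ?case
    by (simp add: sig_ok_ctx_ok_kind_ok_fam_has_obj_has.fam_inter)
next
  case (fam_union \<Sigma> \<Gamma> \<sigma> \<tau>)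
  then show ?case
    by (simp add: sig_ok_ctx_ok_kind_ok_fam_has_obj_has.fam_union)
next
  case (obj_inl \<Sigma> \<Gamma> \<Delta> \<sigma> \<tau>)
  then show ?case
    by (simp add: sig_ok_ctx_ok_kind_ok_fam_has_obj_has.obj_inl)
next
  case (obj_inr \<Sigma> \<Gamma> \<Delta> \<tau> \<sigma>)
  then show ?case
    by (simp add: sig_ok_ctx_ok_kind_ok_fam_has_obj_has.obj_inr)
qed

lemmas kind_ok_sub_general = typing_sub_general(3)[THEN conjunct2, rule_format]
lemmas fam_has_sub_general = typing_sub_general(4)[THEN conjunct2, rule_format]
lemmas obj_has_sub_general = typing_sub_general(5)[THEN conjunct2, rule_format]

section \<open>Typed renamings and typed substitutions\<close>

lemma ren_fam_add_Suc: "ren_fam (\<lambda>n. n + Suc (Suc i)) \<sigma> = ren_fam Suc (ren_fam (\<lambda>n. n + Suc i) \<sigma>)"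
  by (simp add: ren_ren comp_def)

text \<open>Apart from validity of the target, the condition compares context entries only. It can
  therefore be lifted under a binder without any weakening, which it is meant to establish. The
  renaming is presented as \<open>Var \<circ> \<xi>\<close> to fit the general substitution
  lemma.\<close>

definition ren_typed :: "bool \<Rightarrow> ('a, 'c) sig \<Rightarrow> (nat \<Rightarrow> ('a, 'c) obj) \<Rightarrow> ('a, 'c) ctx \<Rightarrow> ('a, 'c) ctx \<Rightarrow> bool"
  where "ren_typed strict \<Sigma> \<theta> \<Gamma> \<Gamma>' \<longleftrightarrow> ctx_ok strict \<Sigma> \<Gamma>' \<and> (\<exists>\<xi>. \<theta> = Var \<circ> \<xi> \<and> (\<forall>i<length \<Gamma>. \<xi> i < length \<Gamma>' \<and>
    ren_fam (\<lambda>n. n + Suc (\<xi> i)) (\<Gamma>' ! \<xi> i) = sub_fam \<theta> (ren_fam (\<lambda>n. n + Suc i) (\<Gamma> ! i))))"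

lemma ren_typed_up:
  assumes "ren_typed strict \<Sigma> \<theta> \<Gamma> \<Gamma>'" "fam_has strict \<Sigma> \<Gamma>' (sub_fam \<theta> \<sigma>) KType"
  shows "ren_typed strict \<Sigma> (up_sub \<theta>) (\<sigma> # \<Gamma>) (sub_fam \<theta> \<sigma> # \<Gamma>')"
proof -
  obtain \<xi> where \<xi>: "\<theta> = Var \<circ> \<xi>" "\<And>i. i < length \<Gamma> \<Longrightarrow> \<xi> i < length \<Gamma>'"
    "\<And>i. i < length \<Gamma> \<Longrightarrow>
      ren_fam (\<lambda>n. n + Suc (\<xi> i)) (\<Gamma>' ! \<xi> i) = sub_fam \<theta> (ren_fam (\<lambda>n. n + Suc i) (\<Gamma> ! i))"
    using assms(1) unfolding ren_typed_def by blast
  have "up_ren \<xi> i < length (sub_fam \<theta> \<sigma> # \<Gamma>') \<and>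
      ren_fam (\<lambda>n. n + Suc (up_ren \<xi> i)) ((sub_fam \<theta> \<sigma> # \<Gamma>') ! up_ren \<xi> i) =
      sub_fam (up_sub \<theta>) (ren_fam (\<lambda>n. n + Suc i) ((\<sigma> # \<Gamma>) ! i))" if "i < length (\<sigma> # \<Gamma>)" for i
  proof (cases i)
    case 0
    then show ?thesis
      by (simp add: sub_up_ren_Suc)
  next
    case (Suc j)
    with that \<xi> show ?thesis
      by (simp only: up_ren_simps nth_Cons_Suc ren_fam_add_Suc sub_up_ren_Suc) simp
  qed
  moreover have "up_sub \<theta> = Var \<circ> up_ren \<xi>"
    by (simp add: \<xi>(1) up_sub_Var)
  ultimately show ?thesis
    using assms by (auto simp: ren_typed_def intro!: typing_intros)
qed

lemma ren_typed_var:
  assumes "ren_typed strict \<Sigma> \<theta> \<Gamma> \<Gamma>'" "i < length \<Gamma>"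
  shows "obj_has strict \<Sigma> \<Gamma>' (\<theta> i) (sub_fam \<theta> (ren_fam (\<lambda>n. n + Suc i) (\<Gamma> ! i)))"
  using assms unfolding ren_typed_def by (metis comp_apply obj_var)

lemma ren_typed_wf: "ren_typed strict \<Sigma> \<theta> \<Gamma> \<Gamma>' \<Longrightarrow> wf_obj strict (\<theta> n)"
  by (auto simp: ren_typed_def)

lemma ren_typed_ctx: "ren_typed strict \<Sigma> \<theta> \<Gamma> \<Gamma>' \<Longrightarrow> ctx_ok strict \<Sigma> \<Gamma>'"
  by (simp add: ren_typed_def)

lemmas ren_typed_facts = ren_typed_ctx ren_typed_var ren_typed_wf ren_typed_up

lemma ren_typed_Suc:
  assumes "fam_has strict \<Sigma> \<Gamma> \<sigma> KType"
  shows "ren_typed strict \<Sigma> (Var \<circ> Suc) \<Gamma> (\<sigma> # \<Gamma>)"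
proof -
  have "ctx_ok strict \<Sigma> (\<sigma> # \<Gamma>)"
    using assms by (blast intro: typing_intros typing_ctx_ok(4))
  then show ?thesis
    unfolding ren_typed_def
    by (intro conjI exI[of _ Suc]) (simp_all only: ren_fam_add_Suc ren_eq_sub(1)[of Suc] nth_Cons_Suc, simp_all)
qed

lemma fam_has_weaken:
  assumes "fam_has strict \<Sigma> \<Gamma> \<tau> KType" "fam_has strict \<Sigma> \<Gamma> \<sigma> KType"
  shows "fam_has strict \<Sigma> (\<sigma> # \<Gamma>) (ren_fam Suc \<tau>) KType"
proof -
  have "fam_has strict \<Sigma> (\<sigma> # \<Gamma>) (sub_fam (Var \<circ> Suc) \<tau>) (sub_kind (Var \<circ> Suc) KType)"
    by (rule fam_has_sub_general[where T = "ren_typed strict", OF _ _ _ _ assms(1) ren_typed_Suc[OF assms(2)]])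
      (rule ren_typed_facts; assumption)+
  then show ?thesis
    by (simp add: ren_eq_sub)
qed

lemma obj_has_weaken:
  assumes "obj_has strict \<Sigma> \<Gamma> \<Delta> \<tau>" "fam_has strict \<Sigma> \<Gamma> \<sigma> KType"
  shows "obj_has strict \<Sigma> (\<sigma> # \<Gamma>) (ren_obj Suc \<Delta>) (ren_fam Suc \<tau>)"
proof -
  have "obj_has strict \<Sigma> (\<sigma> # \<Gamma>) (sub_obj (Var \<circ> Suc) \<Delta>) (sub_fam (Var \<circ> Suc) \<tau>)"
    by (rule obj_has_sub_general[where T = "ren_typed strict", OF _ _ _ _ assms(1) ren_typed_Suc[OF assms(2)]])
      (rule ren_typed_facts; assumption)+
  then show ?thesis
    by (simp add: ren_eq_sub)
qed

text \<open>Admissibility is required at every index, also beyond \<open>length \<Gamma>\<close>,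
  because the conversion chains to be substituted into pass through untyped terms with arbitrary
  indices.\<close>

definition sub_typed :: "bool \<Rightarrow> ('a, 'c) sig \<Rightarrow> (nat \<Rightarrow> ('a, 'c) obj) \<Rightarrow> ('a, 'c) ctx \<Rightarrow> ('a, 'c) ctx \<Rightarrow> bool"
  where "sub_typed strict \<Sigma> \<theta> \<Gamma> \<Gamma>' \<longleftrightarrow> ctx_ok strict \<Sigma> \<Gamma>' \<and> (\<forall>n. wf_obj strict (\<theta> n)) \<and>
    (\<forall>i<length \<Gamma>. obj_has strict \<Sigma> \<Gamma>' (\<theta> i) (sub_fam \<theta> (ren_fam (\<lambda>n. n + Suc i) (\<Gamma> ! i))))"

lemma sub_typed_ConsI:
  assumes "ctx_ok strict \<Sigma> \<Gamma>'" "\<And>n. wf_obj strict (\<theta> n)"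
    and "obj_has strict \<Sigma> \<Gamma>' (\<theta> 0) (sub_fam \<theta> (ren_fam Suc \<sigma>))"
    and "\<And>i. i < length \<Gamma> \<Longrightarrow> obj_has strict \<Sigma> \<Gamma>' (\<theta> (Suc i))
      (sub_fam \<theta> (ren_fam Suc (ren_fam (\<lambda>n. n + Suc i) (\<Gamma> ! i))))"
  shows "sub_typed strict \<Sigma> \<theta> (\<sigma> # \<Gamma>) \<Gamma>'"
proof -
  have "obj_has strict \<Sigma> \<Gamma>' (\<theta> i) (sub_fam \<theta> (ren_fam (\<lambda>n. n + Suc i) ((\<sigma> # \<Gamma>) ! i)))"
    if "i < length (\<sigma> # \<Gamma>)" for i
  proof (cases i)
    case 0
    then show ?thesis
      using assms(3) by simp
  next
    case (Suc j)
    then show ?thesis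
      using assms(4)[of j] that by (simp only: nth_Cons_Suc ren_fam_add_Suc) simp
  qed
  with assms(1,2) show ?thesis
    by (simp add: sub_typed_def)
qed

lemma sub_typed_up:
  assumes "sub_typed strict \<Sigma> \<theta> \<Gamma> \<Gamma>'" "fam_has strict \<Sigma> \<Gamma>' (sub_fam \<theta> \<sigma>) KType"
  shows "sub_typed strict \<Sigma> (up_sub \<theta>) (\<sigma> # \<Gamma>) (sub_fam \<theta> \<sigma> # \<Gamma>')"
proof (rule sub_typed_ConsI)
  show ctx: "ctx_ok strict \<Sigma> (sub_fam \<theta> \<sigma> # \<Gamma>')"
    using assms by (auto simp: sub_typed_def intro: typing_intros)
  show "wf_obj strict (up_sub \<theta> n)" for n
    using assms by (auto simp: sub_typed_def intro: wf_up_sub)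
  show "obj_has strict \<Sigma> (sub_fam \<theta> \<sigma> # \<Gamma>') (up_sub \<theta> 0) (sub_fam (up_sub \<theta>) (ren_fam Suc \<sigma>))"
    using obj_var[OF ctx, of 0] by (simp add: sub_up_ren_Suc)
  show "obj_has strict \<Sigma> (sub_fam \<theta> \<sigma> # \<Gamma>') (up_sub \<theta> (Suc i))
      (sub_fam (up_sub \<theta>) (ren_fam Suc (ren_fam (\<lambda>n. n + Suc i) (\<Gamma> ! i))))" if "i < length \<Gamma>" for i
    using assms that unfolding sub_typed_def sub_up_ren_Suc up_sub_simps by (blast intro: obj_has_weaken)
qed

lemma sub_typed_var:
  "sub_typed strict \<Sigma> \<theta> \<Gamma> \<Gamma>' \<Longrightarrow> i < length \<Gamma> \<Longrightarrow>
    obj_has strict \<Sigma> \<Gamma>' (\<theta> i) (sub_fam \<theta> (ren_fam (\<lambda>n. n + Suc i) (\<Gamma> ! i)))"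
  by (simp add: sub_typed_def)

lemma sub_typed_wf: "sub_typed strict \<Sigma> \<theta> \<Gamma> \<Gamma>' \<Longrightarrow> wf_obj strict (\<theta> n)"
  by (simp add: sub_typed_def)

lemma sub_typed_ctx: "sub_typed strict \<Sigma> \<theta> \<Gamma> \<Gamma>' \<Longrightarrow> ctx_ok strict \<Sigma> \<Gamma>'"
  by (simp add: sub_typed_def)

lemmas sub_typed_facts = sub_typed_ctx sub_typed_var sub_typed_wf sub_typed_up

lemma kind_ok_sub:
  assumes "kind_ok strict \<Sigma> \<Gamma> K" "sub_typed strict \<Sigma> \<theta> \<Gamma> \<Gamma>'"
  shows "kind_ok strict \<Sigma> \<Gamma>' (sub_kind \<theta> K)"
  by (rule kind_ok_sub_general[where T = "sub_typed strict", OF _ _ _ _ assms])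
    (rule sub_typed_facts; assumption)+

lemma fam_has_sub:
  assumes "fam_has strict \<Sigma> \<Gamma> \<sigma> K" "sub_typed strict \<Sigma> \<theta> \<Gamma> \<Gamma>'"
  shows "fam_has strict \<Sigma> \<Gamma>' (sub_fam \<theta> \<sigma>) (sub_kind \<theta> K)"
  by (rule fam_has_sub_general[where T = "sub_typed strict", OF _ _ _ _ assms])
    (rule sub_typed_facts; assumption)+

lemma obj_has_sub:
  assumes "obj_has strict \<Sigma> \<Gamma> \<Delta> \<sigma>" "sub_typed strict \<Sigma> \<theta> \<Gamma> \<Gamma>'"
  shows "obj_has strict \<Sigma> \<Gamma>' (sub_obj \<theta> \<Delta>) (sub_fam \<theta> \<sigma>)"
  by (rule obj_has_sub_general[where T = "sub_typed strict", OF _ _ _ _ assms])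
    (rule sub_typed_facts; assumption)+

lemma sub_typed_inst:
  assumes "obj_has strict \<Sigma> \<Gamma> \<Delta> \<sigma>"
  shows "sub_typed strict \<Sigma> (inst \<Delta>) (\<sigma> # \<Gamma>) \<Gamma>"
proof (rule sub_typed_ConsI)
  show ctx: "ctx_ok strict \<Sigma> \<Gamma>"
    using assms by (rule typing_ctx_ok(5))
  show "wf_obj strict (inst \<Delta> n)" for n
    using assms by (blast intro: wf_inst obj_has_wf)
  show "obj_has strict \<Sigma> \<Gamma> (inst \<Delta> 0) (sub_fam (inst \<Delta>) (ren_fam Suc \<sigma>))"
    using assms by simp
  show "obj_has strict \<Sigma> \<Gamma> (inst \<Delta> (Suc i))
      (sub_fam (inst \<Delta>) (ren_fam Suc (ren_fam (\<lambda>n. n + Suc i) (\<Gamma> ! i))))" if "i < length \<Gamma>" for i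
    using ctx that unfolding sub_inst_ren_Suc inst_simps by (rule obj_var)
qed

lemmas kind_ok_inst = kind_ok_sub[OF _ sub_typed_inst]
lemmas fam_has_inst = fam_has_sub[OF _ sub_typed_inst]
lemmas obj_has_inst = obj_has_sub[OF _ sub_typed_inst]

text \<open>Replacing a context entry by a convertible one is the identity substitution: in the new
  context, variable 0 regains its old type by the conversion rule. Context conversion thus becomes
  an instance of the substitution lemmas.\<close>

lemma sub_typed_ctx_conv:
  assumes "fam_has strict \<Sigma> \<Gamma> \<sigma> KType" "fam_has strict \<Sigma> \<Gamma> \<sigma>' KType" "conv_fam strict \<sigma> \<sigma>'"
  shows "sub_typed strict \<Sigma> Var (\<sigma> # \<Gamma>) (\<sigma>' # \<Gamma>)"
proof (rule sub_typed_ConsI)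
  show ctx: "ctx_ok strict \<Sigma> (\<sigma>' # \<Gamma>)"
    using assms by (blast intro: typing_intros typing_ctx_ok(4))
  show "wf_obj strict (Var n)" for n
    by simp
  have "obj_has strict \<Sigma> (\<sigma>' # \<Gamma>) (Var 0) (ren_fam Suc \<sigma>')"
    using obj_var[OF ctx, of 0] by simp
  then show "obj_has strict \<Sigma> (\<sigma>' # \<Gamma>) (Var 0) (sub_fam Var (ren_fam Suc \<sigma>))"
    unfolding sub_Var by (rule obj_conv) (auto intro: fam_has_weaken conv_fam_ren conv_sym assms)
  show "obj_has strict \<Sigma> (\<sigma>' # \<Gamma>) (Var (Suc i))
      (sub_fam Var (ren_fam Suc (ren_fam (\<lambda>n. n + Suc i) (\<Gamma> ! i))))" if "i < length \<Gamma>" for i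
    using obj_var[OF ctx, of "Suc i"] that unfolding sub_Var nth_Cons_Suc ren_fam_add_Suc by simp
qed

lemma typing_ctx_conv:
  assumes "fam_has strict \<Sigma> \<Gamma> \<sigma> KType" "fam_has strict \<Sigma> \<Gamma> \<sigma>' KType" "conv_fam strict \<sigma> \<sigma>'"
  shows "kind_ok strict \<Sigma> (\<sigma> # \<Gamma>) K \<Longrightarrow> kind_ok strict \<Sigma> (\<sigma>' # \<Gamma>) K"
    and "fam_has strict \<Sigma> (\<sigma> # \<Gamma>) \<tau> K \<Longrightarrow> fam_has strict \<Sigma> (\<sigma>' # \<Gamma>) \<tau> K"
    and "obj_has strict \<Sigma> (\<sigma> # \<Gamma>) \<Delta> \<tau> \<Longrightarrow> obj_has strict \<Sigma> (\<sigma>' # \<Gamma>) \<Delta> \<tau>"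
  using kind_ok_sub[OF _ sub_typed_ctx_conv[OF assms]] fam_has_sub[OF _ sub_typed_ctx_conv[OF assms]]
    obj_has_sub[OF _ sub_typed_ctx_conv[OF assms]] by simp_all

section \<open>Generation and regularity\<close>

text \<open>A declaration is checked against the older part of the signature but used in all of it.
  Inclusion of sets suffices because lookup is by membership.\<close>

lemma typing_sig_weaken:
  shows "sig_ok strict \<Sigma> \<Longrightarrow> True"
    and "ctx_ok strict \<Sigma> \<Gamma> \<Longrightarrow> set \<Sigma> \<subseteq> set \<Sigma>' \<longrightarrow> sig_ok strict \<Sigma>' \<longrightarrow> ctx_ok strict \<Sigma>' \<Gamma>"
    and "kind_ok strict \<Sigma> \<Gamma> K \<Longrightarrow> set \<Sigma> \<subseteq> set \<Sigma>' \<longrightarrow> sig_ok strict \<Sigma>' \<longrightarrow> kind_ok strict \<Sigma>' \<Gamma> K"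
    and "fam_has strict \<Sigma> \<Gamma> \<sigma> K \<Longrightarrow> set \<Sigma> \<subseteq> set \<Sigma>' \<longrightarrow> sig_ok strict \<Sigma>' \<longrightarrow> fam_has strict \<Sigma>' \<Gamma> \<sigma> K"
    and "obj_has strict \<Sigma> \<Gamma> \<Delta> \<sigma> \<Longrightarrow> set \<Sigma> \<subseteq> set \<Sigma>' \<longrightarrow> sig_ok strict \<Sigma>' \<longrightarrow> obj_has strict \<Sigma>' \<Gamma> \<Delta> \<sigma>"
proof (induction rule: typing_induct)
  case (obj_var \<Sigma> \<Gamma> i)
  then show ?case
    using sig_ok_ctx_ok_kind_ok_fam_has_obj_has.obj_var[of strict \<Sigma>' \<Gamma> i] by blast
next
  case conv: fam_conv
  then show ?case
    by (meson fam_conv)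
next
  case conv: obj_conv
  then show ?case
    by (meson obj_conv)
qed (auto intro: typing_intros)

lemma sig_decl_ok:
  assumes "sig_ok strict \<Sigma>"
  shows "FamDecl a K \<in> set \<Sigma> \<Longrightarrow> kind_ok strict \<Sigma> [] K"
    and "ObjDecl c \<sigma> \<in> set \<Sigma> \<Longrightarrow> fam_has strict \<Sigma> [] \<sigma> KType"
proof -
  have "(FamDecl a K \<in> set \<Sigma> \<longrightarrow> kind_ok strict \<Sigma> [] K) \<and>
    (ObjDecl c \<sigma> \<in> set \<Sigma> \<longrightarrow> fam_has strict \<Sigma> [] \<sigma> KType)"
    using assms
  proof (induction \<Sigma> rule: list.induct)
    case (Cons d \<Sigma>)
    from Cons.prems have "sig_ok strict \<Sigma>"
      by cases
    with Cons.IH have IH: "FamDecl a K \<in> set \<Sigma> \<Longrightarrow> kind_ok strict \<Sigma> [] K"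
      "ObjDecl c \<sigma> \<in> set \<Sigma> \<Longrightarrow> fam_has strict \<Sigma> [] \<sigma> KType"
      by auto
    have "kind_ok strict \<Sigma> [] K" if "FamDecl a K \<in> set (d # \<Sigma>)"
      using Cons.prems by cases (use that IH in auto)
    moreover have "fam_has strict \<Sigma> [] \<sigma> KType" if "ObjDecl c \<sigma> \<in> set (d # \<Sigma>)"
      using Cons.prems by cases (use that IH in auto)
    ultimately show ?case
      using Cons.prems by (meson set_subset_Cons typing_sig_weaken(3,4))
  qed simp
  then show "FamDecl a K \<in> set \<Sigma> \<Longrightarrow> kind_ok strict \<Sigma> [] K"
    and "ObjDecl c \<sigma> \<in> set \<Sigma> \<Longrightarrow> fam_has strict \<Sigma> [] \<sigma> KType"
    by auto
qed

text \<open>Carries closed declarations from the empty context to any \<open>\<Gamma>\<close> in one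
  step.\<close>

lemma sub_typed_Nil: "ctx_ok strict \<Sigma> \<Gamma> \<Longrightarrow> sub_typed strict \<Sigma> Var [] \<Gamma>"
  by (simp add: sub_typed_def)

text \<open>For the type formers the kind is exactly \<open>KType\<close>, since
  \<open>KType\<close> converts only to itself; a residual conversion remains for
  \<open>FApp\<close> alone.\<close>

lemma fam_has_generation:
  shows "sig_ok strict \<Sigma> \<Longrightarrow> True"
    and "ctx_ok strict \<Sigma> \<Gamma> \<Longrightarrow> True"
    and "kind_ok strict \<Sigma> \<Gamma> K \<Longrightarrow> True"
    and "fam_has strict \<Sigma> \<Gamma> \<sigma> K \<Longrightarrow> (case \<sigma> of
      FConst a \<Rightarrow> True
    | FPi \<sigma> \<tau> \<Rightarrow> K = KType \<and> fam_has strict \<Sigma> (\<sigma> # \<Gamma>) \<tau> KType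
    | FApp \<sigma> \<Delta> \<Rightarrow> \<exists>\<tau> L. fam_has strict \<Sigma> \<Gamma> \<sigma> (KPi \<tau> L) \<and> obj_has strict \<Sigma> \<Gamma> \<Delta> \<tau> \<and>
        conv_kind strict (sub_kind (inst \<Delta>) L) K
    | FRel \<sigma> \<tau> \<Rightarrow> K = KType \<and> fam_has strict \<Sigma> \<Gamma> \<sigma> KType \<and> fam_has strict \<Sigma> \<Gamma> \<tau> KType
    | FInter \<sigma> \<tau> \<Rightarrow> K = KType \<and> fam_has strict \<Sigma> \<Gamma> \<sigma> KType \<and> fam_has strict \<Sigma> \<Gamma> \<tau> KType
    | FUnion \<sigma> \<tau> \<Rightarrow> K = KType \<and> fam_has strict \<Sigma> \<Gamma> \<sigma> KType \<and> fam_has strict \<Sigma> \<Gamma> \<tau> KType)"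
    and "obj_has strict \<Sigma> \<Gamma> \<Delta> \<sigma> \<Longrightarrow> True"
proof (induction rule: typing_induct)
  case (fam_app \<Sigma> \<Gamma> \<sigma> \<tau> K \<Delta>)
  then show ?case
    by simp (meson conv_refl(2))
next
  case (fam_conv \<Sigma> \<Gamma> \<sigma> K1 K2)
  then show ?case
    by (auto split: fam.splits dest: conv_KTypeD intro: conv_trans)
qed auto

lemma fam_has_generation_simps:
  "fam_has strict \<Sigma> \<Gamma> (FPi \<sigma> \<tau>) K \<longleftrightarrow> K = KType \<and> fam_has strict \<Sigma> (\<sigma> # \<Gamma>) \<tau> KType"
  "fam_has strict \<Sigma> \<Gamma> (FRel \<sigma> \<tau>) K \<longleftrightarrow>
    K = KType \<and> fam_has strict \<Sigma> \<Gamma> \<sigma> KType \<and> fam_has strict \<Sigma> \<Gamma> \<tau> KType"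
  "fam_has strict \<Sigma> \<Gamma> (FInter \<sigma> \<tau>) K \<longleftrightarrow>
    K = KType \<and> fam_has strict \<Sigma> \<Gamma> \<sigma> KType \<and> fam_has strict \<Sigma> \<Gamma> \<tau> KType"
  "fam_has strict \<Sigma> \<Gamma> (FUnion \<sigma> \<tau>) K \<longleftrightarrow>
    K = KType \<and> fam_has strict \<Sigma> \<Gamma> \<sigma> KType \<and> fam_has strict \<Sigma> \<Gamma> \<tau> KType"
  by (rule iffI, (drule fam_has_generation(4), simp)[1],
      (auto intro: fam_pi fam_rel fam_inter fam_union)[1])+

lemma ctx_ok_nth:
  "ctx_ok strict \<Sigma> \<Gamma> \<Longrightarrow> i < length \<Gamma> \<Longrightarrow> fam_has strict \<Sigma> \<Gamma> (ren_fam (\<lambda>n. n + Suc i) (\<Gamma> ! i)) KType"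
proof (induction \<Gamma> arbitrary: i)
  case (Cons \<sigma> \<Gamma>)
  then have *: "ctx_ok strict \<Sigma> \<Gamma>" "fam_has strict \<Sigma> \<Gamma> \<sigma> KType"
    by (auto elim: ctx_ok_ConsE)
  show ?case
  proof (cases i)
    case 0
    then show ?thesis
      using * by (simp add: fam_has_weaken)
  next
    case (Suc j)
    then have "fam_has strict \<Sigma> (\<sigma> # \<Gamma>) (ren_fam Suc (ren_fam (\<lambda>n. n + Suc j) (\<Gamma> ! j))) KType"
      using * Cons.IH[of j] Cons.prems by (intro fam_has_weaken) auto
    then show ?thesis
      unfolding Suc nth_Cons_Suc ren_fam_add_Suc .
  qed
qed simp

text \<open>Declared kinds and types are moved from the empty context to \<open>\<Gamma>\<close> by
  the identity substitution. In the application cases, inverting the well-formedness of the product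
  yields a codomain over the extended context, which is then instantiated.\<close>

lemma typing_regular:
  shows "sig_ok strict \<Sigma> \<Longrightarrow> True"
    and "ctx_ok strict \<Sigma> \<Gamma> \<Longrightarrow> True"
    and "kind_ok strict \<Sigma> \<Gamma> K \<Longrightarrow> True"
    and "fam_has strict \<Sigma> \<Gamma> \<sigma> K \<Longrightarrow> kind_ok strict \<Sigma> \<Gamma> K"
    and "obj_has strict \<Sigma> \<Gamma> \<Delta> \<sigma> \<Longrightarrow> fam_has strict \<Sigma> \<Gamma> \<sigma> KType"
proof (induction rule: typing_induct)
  case (fam_const \<Sigma> \<Gamma> a K)
  then show ?case
    by (metis ctx_ok_sig_ok kind_ok_sub sig_decl_ok(1) sub_kind_Var sub_typed_Nil)
next
  case (fam_pi \<Sigma> \<sigma> \<Gamma> \<tau>)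
  then show ?case
    by (meson ctx_ok_ConsE kind_type typing_ctx_ok(4))
next
  case (fam_app \<Sigma> \<Gamma> \<sigma> \<tau> K \<Delta>)
  then show ?case
    by (auto elim!: kind_ok_KPiE intro: kind_ok_inst)
next
  case (obj_const \<Sigma> \<Gamma> c \<sigma>)
  then show ?case
    by (metis ctx_ok_sig_ok fam_has_sub sig_decl_ok(2) sub_Var(1) sub_kind_Var sub_typed_Nil)
next
  case (obj_app \<Sigma> \<Gamma> \<Delta>1 \<sigma> \<tau> \<Delta>2)
  then show ?case
    using fam_has_inst[of strict \<Sigma> \<sigma> \<Gamma> \<tau> KType] by (auto simp: fam_has_generation_simps)
next
  case (obj_var \<Sigma> \<Gamma> i)
  then show ?case
    by (blast intro: ctx_ok_nth)
qed (auto simp: fam_has_generation_simps intro: kind_type)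

lemma fam_has_head: "ctx_ok strict \<Sigma> (\<sigma> # \<Gamma>) \<Longrightarrow> fam_has strict \<Sigma> \<Gamma> \<sigma> KType"
  by (erule ctx_ok_ConsE)

text \<open>Successive uses of the conversion rule collapse by transitivity into one trailing
  conversion.\<close>

lemma obj_has_generation:
  shows "sig_ok strict \<Sigma> \<Longrightarrow> True"
    and "ctx_ok strict \<Sigma> \<Gamma> \<Longrightarrow> True"
    and "kind_ok strict \<Sigma> \<Gamma> K \<Longrightarrow> True"
    and "fam_has strict \<Sigma> \<Gamma> \<sigma> K \<Longrightarrow> True"
    and "obj_has strict \<Sigma> \<Gamma> \<Delta> \<rho> \<Longrightarrow> (case \<Delta> of
      Const c \<Rightarrow> True
    | Var i \<Rightarrow> True
    | Lam \<sigma> \<Delta> \<Rightarrow> \<exists>\<tau>. obj_has strict \<Sigma> (\<sigma> # \<Gamma>) \<Delta> \<tau> \<and> conv_fam strict (FPi \<sigma> \<tau>) \<rho>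
    | App \<Delta>1 \<Delta>2 \<Rightarrow> \<exists>\<sigma> \<tau>. obj_has strict \<Sigma> \<Gamma> \<Delta>1 (FPi \<sigma> \<tau>) \<and> obj_has strict \<Sigma> \<Gamma> \<Delta>2 \<sigma> \<and>
        conv_fam strict (sub_fam (inst \<Delta>2) \<tau>) \<rho>
    | RLam \<sigma> \<Delta> \<Rightarrow> \<exists>\<tau>. obj_has strict \<Sigma> (\<sigma> # \<Gamma>) \<Delta> (ren_fam Suc \<tau>) \<and> eta_eq (ess \<Delta>) (LVar 0) \<and>
        fam_has strict \<Sigma> \<Gamma> (FRel \<sigma> \<tau>) KType \<and> conv_fam strict (FRel \<sigma> \<tau>) \<rho>
    | RApp \<Delta>1 \<Delta>2 \<Rightarrow> \<exists>\<sigma> \<tau>. obj_has strict \<Sigma> \<Gamma> \<Delta>1 (FRel \<sigma> \<tau>) \<and> obj_has strict \<Sigma> \<Gamma> \<Delta>2 \<sigma> \<and>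
        conv_fam strict \<tau> \<rho>
    | Pair \<Delta>1 \<Delta>2 \<Rightarrow> \<exists>\<sigma> \<tau>. obj_has strict \<Sigma> \<Gamma> \<Delta>1 \<sigma> \<and> obj_has strict \<Sigma> \<Gamma> \<Delta>2 \<tau> \<and>
        eta_eq (ess \<Delta>1) (ess \<Delta>2) \<and> conv_fam strict (FInter \<sigma> \<tau>) \<rho>
    | Copair \<Delta>1 \<Delta>2 \<Rightarrow> \<exists>\<sigma> \<tau> \<rho>'.
        obj_has strict \<Sigma> \<Gamma> \<Delta>1 (FPi \<sigma> (sub_fam (repl (InL (ren_fam Suc \<tau>) (Var 0))) \<rho>')) \<and>
        obj_has strict \<Sigma> \<Gamma> \<Delta>2 (FPi \<tau> (sub_fam (repl (InR (ren_fam Suc \<sigma>) (Var 0))) \<rho>')) \<and>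
        eta_eq (ess \<Delta>1) (ess \<Delta>2) \<and> fam_has strict \<Sigma> (FUnion \<sigma> \<tau> # \<Gamma>) \<rho>' KType \<and>
        conv_fam strict (FPi (FUnion \<sigma> \<tau>) \<rho>') \<rho>
    | PrL \<Delta> \<Rightarrow> \<exists>\<sigma> \<tau>. obj_has strict \<Sigma> \<Gamma> \<Delta> (FInter \<sigma> \<tau>) \<and> conv_fam strict \<sigma> \<rho>
    | PrR \<Delta> \<Rightarrow> \<exists>\<sigma> \<tau>. obj_has strict \<Sigma> \<Gamma> \<Delta> (FInter \<sigma> \<tau>) \<and> conv_fam strict \<tau> \<rho>
    | InL \<tau> \<Delta> \<Rightarrow> \<exists>\<sigma>. obj_has strict \<Sigma> \<Gamma> \<Delta> \<sigma> \<and> fam_has strict \<Sigma> \<Gamma> (FUnion \<sigma> \<tau>) KType \<and>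
        conv_fam strict (FUnion \<sigma> \<tau>) \<rho>
    | InR \<sigma> \<Delta> \<Rightarrow> \<exists>\<tau>. obj_has strict \<Sigma> \<Gamma> \<Delta> \<tau> \<and> fam_has strict \<Sigma> \<Gamma> (FUnion \<sigma> \<tau>) KType \<and>
        conv_fam strict (FUnion \<sigma> \<tau>) \<rho>)"
proof (induction rule: typing_induct)
  case (obj_conv \<Sigma> \<Gamma> \<Delta> \<sigma> \<tau>)
  from obj_conv have conv: "conv_fam strict \<rho> \<sigma> \<Longrightarrow> conv_fam strict \<rho> \<tau>" for \<rho>
    by (blast intro: conv_trans(1))
  from obj_conv show ?case
    by (cases \<Delta>; simp; blast intro: conv)
qed (simp; meson conv_refl(1))+

lemmas obj_has_LamD = obj_has_generation(5)[where \<Delta> = "Lam \<sigma> \<Delta>" for \<sigma> \<Delta>, simplified]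
lemmas obj_has_AppD = obj_has_generation(5)[where \<Delta> = "App \<Delta>1 \<Delta>2" for \<Delta>1 \<Delta>2, simplified]
lemmas obj_has_RLamD = obj_has_generation(5)[where \<Delta> = "RLam \<sigma> \<Delta>" for \<sigma> \<Delta>, simplified]
lemmas obj_has_RAppD = obj_has_generation(5)[where \<Delta> = "RApp \<Delta>1 \<Delta>2" for \<Delta>1 \<Delta>2, simplified]
lemmas obj_has_PairD = obj_has_generation(5)[where \<Delta> = "Pair \<Delta>1 \<Delta>2" for \<Delta>1 \<Delta>2, simplified]
lemmas obj_has_CopairD = obj_has_generation(5)[where \<Delta> = "Copair \<Delta>1 \<Delta>2" for \<Delta>1 \<Delta>2, simplified]
lemmas obj_has_PrLD = obj_has_generation(5)[where \<Delta> = "PrL \<Delta>" for \<Delta>, simplified]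
lemmas obj_has_PrRD = obj_has_generation(5)[where \<Delta> = "PrR \<Delta>" for \<Delta>, simplified]
lemmas obj_has_InLD = obj_has_generation(5)[where \<Delta> = "InL \<tau> \<Delta>" for \<tau> \<Delta>, simplified]
lemmas obj_has_InRD = obj_has_generation(5)[where \<Delta> = "InR \<tau> \<Delta>" for \<tau> \<Delta>, simplified]

section \<open>Subject reduction\<close>

text \<open>Among the contractions, typing matters in three: \<open>prr_pair\<close> and
  \<open>copair_inr\<close> switch to the component that \<open>ess\<close> ignores, eta-equal only
  by typing, and in \<open>beta_rel\<close> the body is eta-equal to its variable, so its instance
  is eta-equal to the argument. At most one beta step arises, because \<open>ess\<close> sees one
  component of a pair.\<close>

lemma red_ess:
  fixes \<sigma> \<sigma>' :: "('a, 'c) fam" and \<Delta> \<Delta>' :: "('a, 'c) obj"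
  shows "red_fam \<sigma> \<sigma>' \<Longrightarrow> True"
    and "red_obj \<Delta> \<Delta>' \<Longrightarrow> \<forall>\<Gamma> \<rho>. obj_has strict \<Sigma> \<Gamma> \<Delta> \<rho> \<longrightarrow>
      eta_eq (ess \<Delta>) (ess \<Delta>') \<or> beta_lam (ess \<Delta>) (ess \<Delta>')"
proof (induction rule: red_fam_red_obj.inducts)
  case (beta \<sigma> \<Delta>1 \<Delta>2)
  then show ?case
    by (simp add: ess_sub_inst beta_lam.beta)
next
  case (prr_pair \<Delta>1 \<Delta>2)
  then show ?case
    by (auto dest!: obj_has_PrRD obj_has_PairD)
next
  case (copair_inr \<Delta>1 \<Delta>2 \<sigma> \<Delta>3)
  then show ?case
    by (auto dest!: obj_has_AppD obj_has_CopairD intro: eta_eq_cong)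
next
  case (beta_rel \<sigma> \<Delta>1 \<Delta>2)
  have "eta_eq (ess \<Delta>2) (ess (sub_obj (inst \<Delta>2) \<Delta>1))"
    if "obj_has strict \<Sigma> \<Gamma> (RApp (RLam \<sigma> \<Delta>1) \<Delta>2) \<rho>" for \<Gamma> \<rho>
  proof -
    have "eta_eq (LVar 0) (ess \<Delta>1)"
      using that by (auto dest!: obj_has_RAppD obj_has_RLamD intro: eta_eq_sym)
    then show ?thesis
      using eta_eq_sub_lam[of "LVar 0" "ess \<Delta>1" "inst_lam (ess \<Delta>2)"] by (simp add: ess_sub_inst)
  qed
  then show ?case
    by simp
next
  case (lam2 \<Delta> \<Delta>' \<sigma>)
  then show ?case
    by (fastforce dest!: obj_has_LamD intro: eta_eq_cong beta_lam.lam)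
next
  case (rlam2 \<Delta> \<Delta>' \<sigma>)
  then show ?case
    by (fastforce dest!: obj_has_RLamD intro: eta_eq_cong beta_lam.lam)
next
  case (app1 \<Delta>1 \<Delta>1' \<Delta>2)
  then show ?case
    by (fastforce dest!: obj_has_AppD intro: eta_eq_cong beta_lam.app1)
next
  case (app2 \<Delta>2 \<Delta>2' \<Delta>1)
  then show ?case
    by (fastforce dest!: obj_has_AppD intro: eta_eq_cong beta_lam.app2)
next
  case (rapp2 \<Delta>2 \<Delta>2' \<Delta>1)
  then show ?case
    by (fastforce dest!: obj_has_RAppD)
next
  case (pair \<Delta>1 \<Delta>1' \<Delta>2 \<Delta>2')
  then show ?case
    by (fastforce dest!: obj_has_PairD)
next
  case (copair \<Delta>1 \<Delta>1' \<Delta>2 \<Delta>2')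
  then show ?case
    by (fastforce dest!: obj_has_CopairD)
next
  case (prl \<Delta> \<Delta>')
  then show ?case
    by (fastforce dest!: obj_has_PrLD)
next
  case (prr \<Delta> \<Delta>')
  then show ?case
    by (fastforce dest!: obj_has_PrRD)
next
  case (inl2 \<Delta> \<Delta>' \<sigma>)
  then show ?case
    by (fastforce dest!: obj_has_InLD)
next
  case (inr2 \<Delta> \<Delta>' \<sigma>)
  then show ?case
    by (fastforce dest!: obj_has_InRD)
qed simp_all

lemma red_eta_eq_LVar:
  assumes "red_obj \<Delta> \<Delta>'" "obj_has strict \<Sigma> \<Gamma> \<Delta> \<rho>" "eta_eq (ess \<Delta>) (LVar n)"
  shows "eta_eq (ess \<Delta>') (LVar n)"
  using red_ess(2)[OF assms(1)] assms(2,3) by (blast intro: eta_eq_trans eta_eq_sym eta_eq_LVar_beta)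

text \<open>The witness \<open>\<Delta>'\<close> serves to make \<open>\<tau>\<close> well-kinded by
  regularity. In subject reduction it is the unreduced object, whose type the reduct has to
  regain.\<close>

lemma obj_has_conv:
  assumes "obj_has strict \<Sigma> \<Gamma> \<Delta> \<sigma>" "conv_fam strict \<sigma> \<tau>" "obj_has strict \<Sigma> \<Gamma> \<Delta>' \<tau>"
  shows "obj_has strict \<Sigma> \<Gamma> \<Delta> \<tau>"
  using assms by (blast intro: obj_conv typing_regular(5))

lemma obj_has_type_wf: "obj_has strict \<Sigma> \<Gamma> \<Delta> \<sigma> \<Longrightarrow> wf_fam strict \<sigma>"
  by (blast intro: fam_has_wf typing_regular(5))

lemma fam_red_conv:
  assumes "red_fam \<sigma> \<sigma>'" "fam_has strict \<Sigma> \<Gamma> \<sigma> K" "fam_has strict \<Sigma> \<Gamma> \<sigma>' K"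
  shows "conv_fam strict \<sigma> \<sigma>'"
  using assms by (blast intro: conv_red fam_has_wf)

lemma conv_obj_InL: "conv_fam strict \<sigma> \<sigma>' \<Longrightarrow> wf_obj strict \<Delta> \<Longrightarrow> conv_obj strict (InL \<sigma> \<Delta>) (InL \<sigma>' \<Delta>)"
  by (erule conv_obj_map_fam) (auto intro: conv_red(3) inl1)

lemma conv_obj_InR: "conv_fam strict \<sigma> \<sigma>' \<Longrightarrow> wf_obj strict \<Delta> \<Longrightarrow> conv_obj strict (InR \<sigma> \<Delta>) (InR \<sigma>' \<Delta>)"
  by (erule conv_obj_map_fam) (auto intro: conv_red(3) inr1)

section \<open>Contractions preserve types\<close>

text \<open>Generation yields one product for the application and one for the abstraction, matched
  by injectivity. The argument is retyped at the annotation \<open>\<sigma>\<close>, which is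
  well-kinded as head of the context of the body.\<close>

lemma beta_typed:
  assumes "obj_has strict \<Sigma> \<Gamma> (App (Lam \<sigma> \<Delta>1) \<Delta>2) \<rho>"
  shows "obj_has strict \<Sigma> \<Gamma> (sub_obj (inst \<Delta>2) \<Delta>1) \<rho>"
proof -
  obtain A B where AB: "obj_has strict \<Sigma> \<Gamma> (Lam \<sigma> \<Delta>1) (FPi A B)" "obj_has strict \<Sigma> \<Gamma> \<Delta>2 A"
    "conv_fam strict (sub_fam (inst \<Delta>2) B) \<rho>"
    using obj_has_AppD[OF assms] by blast
  obtain \<tau> where \<tau>: "obj_has strict \<Sigma> (\<sigma> # \<Gamma>) \<Delta>1 \<tau>" "conv_fam strict \<sigma> A" "conv_fam strict \<tau> B"
    using obj_has_LamD[OF AB(1)] by (auto dest!: conv_FPiD)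
  have "obj_has strict \<Sigma> \<Gamma> \<Delta>2 \<sigma>"
    using AB(2) \<tau>(1,2) by (blast intro: obj_conv conv_sym(1) fam_has_head typing_ctx_ok(5))
  then have "obj_has strict \<Sigma> \<Gamma> (sub_obj (inst \<Delta>2) \<Delta>1) (sub_fam (inst \<Delta>2) \<tau>)"
    by (rule obj_has_inst[OF \<tau>(1)])
  moreover have "conv_fam strict (sub_fam (inst \<Delta>2) \<tau>) (sub_fam (inst \<Delta>2) B)"
    using \<tau>(3) AB(2) by (blast intro: conv_fam_sub wf_inst obj_has_wf)
  ultimately show ?thesis
    using AB(3) assms by (blast intro: obj_has_conv conv_trans(1))
qed

lemma beta_rel_typed:
  assumes "obj_has strict \<Sigma> \<Gamma> (RApp (RLam \<sigma> \<Delta>1) \<Delta>2) \<rho>"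
  shows "obj_has strict \<Sigma> \<Gamma> (sub_obj (inst \<Delta>2) \<Delta>1) \<rho>"
proof -
  obtain A B where AB: "obj_has strict \<Sigma> \<Gamma> (RLam \<sigma> \<Delta>1) (FRel A B)" "obj_has strict \<Sigma> \<Gamma> \<Delta>2 A"
    "conv_fam strict B \<rho>"
    using obj_has_RAppD[OF assms] by blast
  obtain \<tau> where \<tau>: "obj_has strict \<Sigma> (\<sigma> # \<Gamma>) \<Delta>1 (ren_fam Suc \<tau>)" "conv_fam strict \<sigma> A" "conv_fam strict \<tau> B"
    using obj_has_RLamD[OF AB(1)] by (auto dest!: conv_FRelD)
  have "obj_has strict \<Sigma> \<Gamma> \<Delta>2 \<sigma>"
    using AB(2) \<tau>(1,2) by (blast intro: obj_conv conv_sym(1) fam_has_head typing_ctx_ok(5))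
  then have "obj_has strict \<Sigma> \<Gamma> (sub_obj (inst \<Delta>2) \<Delta>1) \<tau>"
    using obj_has_inst[OF \<tau>(1)] by simp
  then show ?thesis
    using \<tau>(3) AB(3) assms by (blast intro: obj_has_conv conv_trans(1))
qed

text \<open>The injection annotation \<open>\<sigma>\<close> need not be the right summand
  \<open>t\<close> with which the branch was checked; injectivity of unions makes them
  convertible.\<close>

lemma copair_inl_typed:
  assumes "obj_has strict \<Sigma> \<Gamma> (App (Copair \<Delta>1 \<Delta>2) (InL \<sigma> \<Delta>3)) \<rho>"
  shows "obj_has strict \<Sigma> \<Gamma> (App \<Delta>1 \<Delta>3) \<rho>"
proof -
  obtain A B where AB: "obj_has strict \<Sigma> \<Gamma> (Copair \<Delta>1 \<Delta>2) (FPi A B)"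
    "obj_has strict \<Sigma> \<Gamma> (InL \<sigma> \<Delta>3) A" "conv_fam strict (sub_fam (inst (InL \<sigma> \<Delta>3)) B) \<rho>"
    using obj_has_AppD[OF assms] by blast
  obtain s t r where str: "obj_has strict \<Sigma> \<Gamma> \<Delta>1 (FPi s (sub_fam (repl (InL (ren_fam Suc t) (Var 0))) r))"
    "fam_has strict \<Sigma> (FUnion s t # \<Gamma>) r KType" "conv_fam strict (FUnion s t) A" "conv_fam strict r B"
    using obj_has_CopairD[OF AB(1)] by (auto dest!: conv_FPiD)
  obtain s' where s': "obj_has strict \<Sigma> \<Gamma> \<Delta>3 s'" "conv_fam strict (FUnion s' \<sigma>) A"
    using obj_has_InLD[OF AB(2)] by blast
  have "conv_fam strict (FUnion s t) (FUnion s' \<sigma>)"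
    using str(3) s'(2) by (blast intro: conv_trans(1) conv_sym(1))
  then have conv: "conv_fam strict s s'" "conv_fam strict t \<sigma>"
    by (auto dest!: conv_FUnionD)
  have "fam_has strict \<Sigma> \<Gamma> (FUnion s t) KType"
    using str(2) by (blast intro: fam_has_head typing_ctx_ok(4))
  then have "obj_has strict \<Sigma> \<Gamma> \<Delta>3 s"
    using s'(1) conv(1) by (auto simp: fam_has_generation_simps intro: obj_conv conv_sym(1))
  then have "obj_has strict \<Sigma> \<Gamma> (App \<Delta>1 \<Delta>3) (sub_fam (inst (InL t \<Delta>3)) r)"
    using obj_app[OF str(1)] by (simp add: sub_inst_repl)
  \<comment> \<open>The contracted application has the motive at \<open>InL t \<Delta>3\<close>, the
    redex has it at \<open>InL \<sigma> \<Delta>3\<close>. Converting between them takes a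
    conversion inside a substituted object.\<close>
  moreover have "conv_fam strict (sub_fam (inst (InL t \<Delta>3)) r) (sub_fam (inst (InL \<sigma> \<Delta>3)) r)"
    using conv(2) s'(1) str(2) by (intro conv_fam_sub_inst conv_obj_InL) (blast intro: obj_has_wf fam_has_wf)+
  moreover have "conv_fam strict (sub_fam (inst (InL \<sigma> \<Delta>3)) r) (sub_fam (inst (InL \<sigma> \<Delta>3)) B)"
    using str(4) AB(2) by (blast intro: conv_fam_sub wf_inst obj_has_wf)
  ultimately show ?thesis
    using AB(3) assms by (blast intro: obj_has_conv conv_trans(1))
qed

lemma copair_inr_typed:
  assumes "obj_has strict \<Sigma> \<Gamma> (App (Copair \<Delta>1 \<Delta>2) (InR \<sigma> \<Delta>3)) \<rho>"
  shows "obj_has strict \<Sigma> \<Gamma> (App \<Delta>2 \<Delta>3) \<rho>"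
proof -
  obtain A B where AB: "obj_has strict \<Sigma> \<Gamma> (Copair \<Delta>1 \<Delta>2) (FPi A B)"
    "obj_has strict \<Sigma> \<Gamma> (InR \<sigma> \<Delta>3) A" "conv_fam strict (sub_fam (inst (InR \<sigma> \<Delta>3)) B) \<rho>"
    using obj_has_AppD[OF assms] by blast
  obtain s t r where str: "obj_has strict \<Sigma> \<Gamma> \<Delta>2 (FPi t (sub_fam (repl (InR (ren_fam Suc s) (Var 0))) r))"
    "fam_has strict \<Sigma> (FUnion s t # \<Gamma>) r KType" "conv_fam strict (FUnion s t) A" "conv_fam strict r B"
    using obj_has_CopairD[OF AB(1)] by (auto dest!: conv_FPiD)
  obtain t' where t': "obj_has strict \<Sigma> \<Gamma> \<Delta>3 t'" "conv_fam strict (FUnion \<sigma> t') A"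
    using obj_has_InRD[OF AB(2)] by blast
  have "conv_fam strict (FUnion s t) (FUnion \<sigma> t')"
    using str(3) t'(2) by (blast intro: conv_trans(1) conv_sym(1))
  then have conv: "conv_fam strict t t'" "conv_fam strict s \<sigma>"
    by (auto dest!: conv_FUnionD)
  have "fam_has strict \<Sigma> \<Gamma> (FUnion s t) KType"
    using str(2) by (blast intro: fam_has_head typing_ctx_ok(4))
  then have "obj_has strict \<Sigma> \<Gamma> \<Delta>3 t"
    using t'(1) conv(1) by (auto simp: fam_has_generation_simps intro: obj_conv conv_sym(1))
  then have "obj_has strict \<Sigma> \<Gamma> (App \<Delta>2 \<Delta>3) (sub_fam (inst (InR s \<Delta>3)) r)"
    using obj_app[OF str(1)] by (simp add: sub_inst_repl)
  moreover have "conv_fam strict (sub_fam (inst (InR s \<Delta>3)) r) (sub_fam (inst (InR \<sigma> \<Delta>3)) r)"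
    using conv(2) t'(1) str(2) by (intro conv_fam_sub_inst conv_obj_InR) (blast intro: obj_has_wf fam_has_wf)+
  moreover have "conv_fam strict (sub_fam (inst (InR \<sigma> \<Delta>3)) r) (sub_fam (inst (InR \<sigma> \<Delta>3)) B)"
    using str(4) AB(2) by (blast intro: conv_fam_sub wf_inst obj_has_wf)
  ultimately show ?thesis
    using AB(3) assms by (blast intro: obj_has_conv conv_trans(1))
qed

lemma subject_reduction_fam_obj:
  shows "red_fam \<sigma> \<sigma>' \<Longrightarrow> fam_has strict \<Sigma> \<Gamma> \<sigma> K \<Longrightarrow> fam_has strict \<Sigma> \<Gamma> \<sigma>' K"
    and "red_obj \<Delta> \<Delta>' \<Longrightarrow> obj_has strict \<Sigma> \<Gamma> \<Delta> \<rho> \<Longrightarrow> obj_has strict \<Sigma> \<Gamma> \<Delta>' \<rho>"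
proof (induction arbitrary: \<Gamma> K and \<Gamma> \<rho> rule: red_fam_red_obj.inducts)
  case (beta \<sigma> \<Delta>1 \<Delta>2)
  then show ?case
    by (rule beta_typed)
next
  case (prl_pair \<Delta>1 \<Delta>2)
  then obtain A B where AB: "obj_has strict \<Sigma> \<Gamma> (Pair \<Delta>1 \<Delta>2) (FInter A B)" "conv_fam strict A \<rho>"
    by (blast dest: obj_has_PrLD)
  then obtain \<sigma> where "obj_has strict \<Sigma> \<Gamma> \<Delta>1 \<sigma>" "conv_fam strict \<sigma> A"
    by (auto dest!: obj_has_PairD conv_FInterD)
  then show ?case
    using AB(2) prl_pair by (blast intro: obj_has_conv conv_trans(1))
next
  case (prr_pair \<Delta>1 \<Delta>2)
  then obtain A B where AB: "obj_has strict \<Sigma> \<Gamma> (Pair \<Delta>1 \<Delta>2) (FInter A B)" "conv_fam strict B \<rho>"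
    by (blast dest: obj_has_PrRD)
  then obtain \<tau> where "obj_has strict \<Sigma> \<Gamma> \<Delta>2 \<tau>" "conv_fam strict \<tau> B"
    by (auto dest!: obj_has_PairD conv_FInterD)
  then show ?case
    using AB(2) prr_pair by (blast intro: obj_has_conv conv_trans(1))
next
  case (copair_inl \<Delta>1 \<Delta>2 \<sigma> \<Delta>3)
  then show ?case
    by (rule copair_inl_typed)
next
  case (copair_inr \<Delta>1 \<Delta>2 \<sigma> \<Delta>3)
  then show ?case
    by (rule copair_inr_typed)
next
  case (beta_rel \<sigma> \<Delta>1 \<Delta>2)
  then show ?case
    by (rule beta_rel_typed)
next
  case (lam1 \<sigma> \<sigma>' \<Delta>)
  obtain \<tau> where \<tau>: "obj_has strict \<Sigma> (\<sigma> # \<Gamma>) \<Delta> \<tau>" "conv_fam strict (FPi \<sigma> \<tau>) \<rho>"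
    using obj_has_LamD[OF lam1.prems] by blast
  have \<sigma>: "fam_has strict \<Sigma> \<Gamma> \<sigma> KType"
    using \<tau>(1) by (blast intro: fam_has_head typing_ctx_ok(5))
  then have \<sigma>': "fam_has strict \<Sigma> \<Gamma> \<sigma>' KType"
    by (rule lam1.IH)
  have conv: "conv_fam strict \<sigma> \<sigma>'"
    using lam1.hyps \<sigma> \<sigma>' by (rule fam_red_conv)
  have "obj_has strict \<Sigma> \<Gamma> (Lam \<sigma>' \<Delta>) (FPi \<sigma>' \<tau>)"
    by (intro obj_lam typing_ctx_conv(3)[OF \<sigma> \<sigma>' conv \<tau>(1)])
  \<comment> \<open>The annotation reappears in the type, so the reduct first gets a product over
    \<open>\<sigma>'\<close>, which is then converted back.\<close>
  moreover have "conv_fam strict (FPi \<sigma>' \<tau>) (FPi \<sigma> \<tau>)"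
    using conv \<tau>(1) \<sigma> by (blast intro: conv_FPi conv_sym(1) conv_refl(1) fam_has_wf obj_has_type_wf)
  ultimately show ?case
    using \<tau>(2) lam1.prems by (blast intro: obj_has_conv conv_trans(1))
next
  case (lam2 \<Delta> \<Delta>' \<sigma>)
  obtain \<tau> where \<tau>: "obj_has strict \<Sigma> (\<sigma> # \<Gamma>) \<Delta> \<tau>" "conv_fam strict (FPi \<sigma> \<tau>) \<rho>"
    using obj_has_LamD[OF lam2.prems] by blast
  show ?case
    by (rule obj_has_conv[OF obj_lam[OF lam2.IH[OF \<tau>(1)]] \<tau>(2) lam2.prems])
next
  case (app1 \<Delta>1 \<Delta>1' \<Delta>2)
  obtain \<sigma> \<tau> where \<tau>: "obj_has strict \<Sigma> \<Gamma> \<Delta>1 (FPi \<sigma> \<tau>)" "obj_has strict \<Sigma> \<Gamma> \<Delta>2 \<sigma>"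
    "conv_fam strict (sub_fam (inst \<Delta>2) \<tau>) \<rho>"
    using obj_has_AppD[OF app1.prems] by blast
  show ?case
    by (rule obj_has_conv[OF obj_app[OF app1.IH[OF \<tau>(1)] \<tau>(2)] \<tau>(3) app1.prems])
next
  case (app2 \<Delta>2 \<Delta>2' \<Delta>1)
  obtain \<sigma> \<tau> where \<tau>: "obj_has strict \<Sigma> \<Gamma> \<Delta>1 (FPi \<sigma> \<tau>)" "obj_has strict \<Sigma> \<Gamma> \<Delta>2 \<sigma>"
    "conv_fam strict (sub_fam (inst \<Delta>2) \<tau>) \<rho>"
    using obj_has_AppD[OF app2.prems] by blast
  note \<Delta>2' = app2.IH[OF \<tau>(2)]
  have "wf_fam strict \<tau>"
    using obj_has_type_wf[OF \<tau>(1)] by simp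
  moreover have "conv_obj strict \<Delta>2' \<Delta>2"
    using app2.hyps \<tau>(2) \<Delta>2' by (blast intro: conv_sym(3) conv_red(3) obj_has_wf)
  \<comment> \<open>The result type contains the argument, so a step in the argument moves the type;
    this conversion brings it back.\<close>
  ultimately have "conv_fam strict (sub_fam (inst \<Delta>2') \<tau>) (sub_fam (inst \<Delta>2) \<tau>)"
    by (blast intro: conv_fam_sub_inst)
  then show ?case
    by (rule obj_has_conv[OF obj_app[OF \<tau>(1) \<Delta>2'] conv_trans(1)[OF _ \<tau>(3)] app2.prems])
next
  case (rlam1 \<sigma> \<sigma>' \<Delta>)
  obtain \<tau> where \<tau>: "obj_has strict \<Sigma> (\<sigma> # \<Gamma>) \<Delta> (ren_fam Suc \<tau>)" "eta_eq (ess \<Delta>) (LVar 0)"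
    "fam_has strict \<Sigma> \<Gamma> (FRel \<sigma> \<tau>) KType" "conv_fam strict (FRel \<sigma> \<tau>) \<rho>"
    using obj_has_RLamD[OF rlam1.prems] by blast
  have \<sigma>: "fam_has strict \<Sigma> \<Gamma> \<sigma> KType" "fam_has strict \<Sigma> \<Gamma> \<tau> KType"
    using \<tau>(3) by (simp_all add: fam_has_generation_simps)
  then have \<sigma>': "fam_has strict \<Sigma> \<Gamma> \<sigma>' KType"
    by (blast intro: rlam1.IH)
  have conv: "conv_fam strict \<sigma> \<sigma>'"
    using rlam1.hyps \<sigma>(1) \<sigma>' by (rule fam_red_conv)
  have "obj_has strict \<Sigma> \<Gamma> (RLam \<sigma>' \<Delta>) (FRel \<sigma>' \<tau>)"
    by (intro obj_rlam typing_ctx_conv(3)[OF \<sigma>(1) \<sigma>' conv \<tau>(1)] \<tau>(2) fam_rel \<sigma>(2) \<sigma>')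
  moreover have "conv_fam strict (FRel \<sigma>' \<tau>) (FRel \<sigma> \<tau>)"
    using conv \<sigma> by (blast intro: conv_FRel conv_sym(1) conv_refl(1) fam_has_wf)
  ultimately show ?case
    using \<tau>(4) rlam1.prems by (blast intro: obj_has_conv conv_trans(1))
next
  case (rlam2 \<Delta> \<Delta>' \<sigma>)
  obtain \<tau> where \<tau>: "obj_has strict \<Sigma> (\<sigma> # \<Gamma>) \<Delta> (ren_fam Suc \<tau>)" "eta_eq (ess \<Delta>) (LVar 0)"
    "fam_has strict \<Sigma> \<Gamma> (FRel \<sigma> \<tau>) KType" "conv_fam strict (FRel \<sigma> \<tau>) \<rho>"
    using obj_has_RLamD[OF rlam2.prems] by blast
  \<comment> \<open>This is the case for which beta and eta on essences were studied: the body must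
    remain eta-equal to its variable.\<close>
  have "obj_has strict \<Sigma> \<Gamma> (RLam \<sigma> \<Delta>') (FRel \<sigma> \<tau>)"
    by (rule obj_rlam[OF rlam2.IH[OF \<tau>(1)] red_eta_eq_LVar[OF rlam2.hyps \<tau>(1,2)] \<tau>(3)])
  then show ?case
    using \<tau>(4) rlam2.prems by (rule obj_has_conv)
next
  case (rapp1 \<Delta>1 \<Delta>1' \<Delta>2)
  then show ?case
    by (meson obj_has_RAppD obj_has_conv obj_rapp)
next
  case (rapp2 \<Delta>2 \<Delta>2' \<Delta>1)
  then show ?case
    by (meson obj_has_RAppD obj_has_conv obj_rapp)
next
  case (pair \<Delta>1 \<Delta>1' \<Delta>2 \<Delta>2')
  obtain \<sigma> \<tau> where \<tau>: "obj_has strict \<Sigma> \<Gamma> \<Delta>1 \<sigma>" "obj_has strict \<Sigma> \<Gamma> \<Delta>2 \<tau>"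
    "conv_fam strict (FInter \<sigma> \<tau>) \<rho>"
    using obj_has_PairD[OF pair.prems] by blast
  \<comment> \<open>Identity of the new essences is a premise of the step and settles both the
    eta-equality and the strict condition.\<close>
  have "obj_has strict \<Sigma> \<Gamma> (Pair \<Delta>1' \<Delta>2') (FInter \<sigma> \<tau>)"
    using pair.IH \<tau>(1,2) pair.hyps by (intro obj_pair) simp_all
  then show ?case
    using \<tau>(3) pair.prems by (rule obj_has_conv)
next
  case (copair \<Delta>1 \<Delta>1' \<Delta>2 \<Delta>2')
  obtain \<sigma> \<tau> \<rho>' where \<tau>:
    "obj_has strict \<Sigma> \<Gamma> \<Delta>1 (FPi \<sigma> (sub_fam (repl (InL (ren_fam Suc \<tau>) (Var 0))) \<rho>'))"
    "obj_has strict \<Sigma> \<Gamma> \<Delta>2 (FPi \<tau> (sub_fam (repl (InR (ren_fam Suc \<sigma>) (Var 0))) \<rho>'))"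
    "fam_has strict \<Sigma> (FUnion \<sigma> \<tau> # \<Gamma>) \<rho>' KType" "conv_fam strict (FPi (FUnion \<sigma> \<tau>) \<rho>') \<rho>"
    using obj_has_CopairD[OF copair.prems] by blast
  have "obj_has strict \<Sigma> \<Gamma> (Copair \<Delta>1' \<Delta>2') (FPi (FUnion \<sigma> \<tau>) \<rho>')"
    using copair.IH \<tau> copair.hyps by (intro obj_copair) simp_all
  then show ?case
    using \<tau>(4) copair.prems by (rule obj_has_conv)
next
  case (prl \<Delta> \<Delta>')
  then show ?case
    by (meson obj_has_PrLD obj_has_conv obj_prl)
next
  case (prr \<Delta> \<Delta>')
  then show ?case
    by (meson obj_has_PrRD obj_has_conv obj_prr)
next
  case (inl1 \<tau> \<tau>' \<Delta>)
  obtain \<sigma> where \<sigma>: "obj_has strict \<Sigma> \<Gamma> \<Delta> \<sigma>" "fam_has strict \<Sigma> \<Gamma> (FUnion \<sigma> \<tau>) KType"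
    "conv_fam strict (FUnion \<sigma> \<tau>) \<rho>"
    using obj_has_InLD[OF inl1.prems] by blast
  have \<tau>: "fam_has strict \<Sigma> \<Gamma> \<sigma> KType" "fam_has strict \<Sigma> \<Gamma> \<tau> KType"
    using \<sigma>(2) by (simp_all add: fam_has_generation_simps)
  then have \<tau>': "fam_has strict \<Sigma> \<Gamma> \<tau>' KType"
    by (blast intro: inl1.IH)
  have "conv_fam strict \<tau> \<tau>'"
    using inl1.hyps \<tau>(2) \<tau>' by (rule fam_red_conv)
  then have "conv_fam strict (FUnion \<sigma> \<tau>') (FUnion \<sigma> \<tau>)"
    using \<tau> \<tau>' by (blast intro: conv_FUnion conv_sym(1) conv_refl(1) fam_has_wf)
  moreover have "obj_has strict \<Sigma> \<Gamma> (InL \<tau>' \<Delta>) (FUnion \<sigma> \<tau>')"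
    by (intro obj_inl fam_union \<sigma>(1) \<tau>(1) \<tau>')
  ultimately show ?case
    using \<sigma>(3) inl1.prems by (blast intro: obj_has_conv conv_trans(1))
next
  case (inl2 \<Delta> \<Delta>' \<tau>)
  then show ?case
    by (meson obj_has_InLD obj_has_conv obj_inl)
next
  case (inr1 \<sigma> \<sigma>' \<Delta>)
  obtain \<tau> where \<tau>: "obj_has strict \<Sigma> \<Gamma> \<Delta> \<tau>" "fam_has strict \<Sigma> \<Gamma> (FUnion \<sigma> \<tau>) KType"
    "conv_fam strict (FUnion \<sigma> \<tau>) \<rho>"
    using obj_has_InRD[OF inr1.prems] by blast
  have \<sigma>: "fam_has strict \<Sigma> \<Gamma> \<sigma> KType" "fam_has strict \<Sigma> \<Gamma> \<tau> KType"
    using \<tau>(2) by (simp_all add: fam_has_generation_simps)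
  then have \<sigma>': "fam_has strict \<Sigma> \<Gamma> \<sigma>' KType"
    by (blast intro: inr1.IH)
  have "conv_fam strict \<sigma> \<sigma>'"
    using inr1.hyps \<sigma>(1) \<sigma>' by (rule fam_red_conv)
  then have "conv_fam strict (FUnion \<sigma>' \<tau>) (FUnion \<sigma> \<tau>)"
    using \<sigma> \<sigma>' by (blast intro: conv_FUnion conv_sym(1) conv_refl(1) fam_has_wf)
  moreover have "obj_has strict \<Sigma> \<Gamma> (InR \<sigma>' \<Delta>) (FUnion \<sigma>' \<tau>)"
    by (intro obj_inr fam_union \<tau>(1) \<sigma>(2) \<sigma>')
  ultimately show ?case
    using \<tau>(3) inr1.prems by (blast intro: obj_has_conv conv_trans(1))
next
  case (inr2 \<Delta> \<Delta>' \<sigma>)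
  then show ?case
    by (meson obj_has_InRD obj_has_conv obj_inr)
next
  case (fpi1 \<sigma> \<sigma>' \<tau>)
  then have *: "K = KType" "fam_has strict \<Sigma> (\<sigma> # \<Gamma>) \<tau> KType"
    by (simp_all add: fam_has_generation_simps)
  then have \<sigma>: "fam_has strict \<Sigma> \<Gamma> \<sigma> KType"
    by (blast intro: fam_has_head typing_ctx_ok(4))
  then have \<sigma>': "fam_has strict \<Sigma> \<Gamma> \<sigma>' KType"
    by (rule fpi1.IH)
  \<comment> \<open>The codomain itself is unchanged but now lives over \<open>\<sigma>'\<close>, so
    its typing is transported by context conversion.\<close>
  show ?case
    using typing_ctx_conv(2)[OF \<sigma> \<sigma>' fam_red_conv[OF fpi1.hyps \<sigma> \<sigma>'] *(2)] *(1) by (simp add: fam_pi)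
next
  case (fapp1 \<sigma> \<sigma>' \<Delta>)
  obtain \<tau> L where *: "fam_has strict \<Sigma> \<Gamma> \<sigma> (KPi \<tau> L)" "obj_has strict \<Sigma> \<Gamma> \<Delta> \<tau>"
    "conv_kind strict (sub_kind (inst \<Delta>) L) K"
    using fam_has_generation(4)[OF fapp1.prems] by auto
  \<comment> \<open>Only the head is reduced, so the instantiated kind stays the same; regularity of
    the original family supplies the well-formedness of \<open>K\<close> for the conversion
    rule.\<close>
  show ?case
    by (rule fam_conv[OF fam_app[OF fapp1.IH[OF *(1)] *(2)] typing_regular(4)[OF fapp1.prems] *(3)])
next
  case (fapp2 \<Delta> \<Delta>' \<sigma>)
  obtain \<tau> L where *: "fam_has strict \<Sigma> \<Gamma> \<sigma> (KPi \<tau> L)" "obj_has strict \<Sigma> \<Gamma> \<Delta> \<tau>"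
    "conv_kind strict (sub_kind (inst \<Delta>) L) K"
    using fam_has_generation(4)[OF fapp2.prems] by auto
  note \<Delta>' = fapp2.IH[OF *(2)]
  have "wf_kind strict L"
    using kind_ok_wf[OF typing_regular(4)[OF *(1)]] by simp
  moreover have "conv_obj strict \<Delta>' \<Delta>"
    using fapp2.hyps *(2) \<Delta>' by (blast intro: conv_sym(3) conv_red(3) obj_has_wf)
  ultimately have "conv_kind strict (sub_kind (inst \<Delta>') L) (sub_kind (inst \<Delta>) L)"
    by (blast intro: conv_kind_sub_inst)
  then show ?case
    by (rule fam_conv[OF fam_app[OF *(1) \<Delta>'] typing_regular(4)[OF fapp2.prems] conv_trans(2)[OF _ *(3)]])
qed (simp_all add: fam_has_generation_simps)

lemma subject_reduction_kind:
  "red_kind K K' \<Longrightarrow> kind_ok strict \<Sigma> \<Gamma> K \<Longrightarrow> kind_ok strict \<Sigma> \<Gamma> K'"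
proof (induction arbitrary: \<Gamma> rule: red_kind.induct)
  case (kpi1 \<sigma> \<sigma>' K)
  from kpi1.prems have K: "kind_ok strict \<Sigma> (\<sigma> # \<Gamma>) K"
    by (rule kind_ok_KPiE)
  then have \<sigma>: "fam_has strict \<Sigma> \<Gamma> \<sigma> KType"
    by (blast intro: fam_has_head typing_ctx_ok(3))
  then have \<sigma>': "fam_has strict \<Sigma> \<Gamma> \<sigma>' KType"
    by (rule subject_reduction_fam_obj(1)[OF kpi1.hyps])
  show ?case
    by (rule kind_pi[OF typing_ctx_conv(1)[OF \<sigma> \<sigma>' fam_red_conv[OF kpi1.hyps \<sigma> \<sigma>'] K]])
next
  case (kpi2 K K' \<sigma>)
  then show ?case
    by (blast elim: kind_ok_KPiE intro: kind_pi)
qed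

theorem theorem6:
  fixes strict :: bool
    and \<Sigma> :: "('a, 'c) sig" and \<Gamma> :: "('a, 'c) ctx"
  shows "(\<forall>K K'. kind_ok strict \<Sigma> \<Gamma> K \<and> red_kind K K' \<longrightarrow> kind_ok strict \<Sigma> \<Gamma> K') \<and>
    (\<forall>\<sigma> K \<sigma>'. fam_has strict \<Sigma> \<Gamma> \<sigma> K \<and> red_fam \<sigma> \<sigma>' \<longrightarrow> fam_has strict \<Sigma> \<Gamma> \<sigma>' K) \<and>
    (\<forall>\<Delta> \<sigma> \<Delta>'. obj_has strict \<Sigma> \<Gamma> \<Delta> \<sigma> \<and> red_obj \<Delta> \<Delta>' \<longrightarrow> obj_has strict \<Sigma> \<Gamma> \<Delta>' \<sigma>)"
  using subject_reduction_kind subject_reduction_fam_obj by blast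

end
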